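(* Let $\mathsf{M}$ be an elementary split matroid of rank $k$ and cardinality $n$, and let $f$ be a valuative invariant (with values in an abelian group). Then \[ f(\mathsf{M}) = f(\mathsf{U}_{k,n}) - \sum_{r,h}\lambda_{r,h}\left(f(\mathsf{\Lambda}_{r,k,h,n}) - f(\mathsf{U}_{k-r,n-h}\oplus\mathsf{U}_{r,h})\right),\] where each $\lambda_{r,h}$ denotes the number of stressed subsets of $\mathsf{M}$ with non-empty cover of size $h$ and rank $r$.
   Context: All matroids have finite ground sets contained in the positive integers. $\mathsf{U}_{k,n}$ is the uniform matroid of rank $k$ on $n$ elements (invariants are evaluated on any matroid in the isomorphism class). Valuative invariants: the base polytope of a matroid $\mathsf{M}$ on $E$ with set of bases $\mathscr{B}$ is $\mathscr{P}(\mathsf{M})=\operatorname{conv}\{\sum_{i\in B}e_i : B\in\mathscr{B}\}\subseteq\mathbb{R}^E$; its indicator function $\mathbb{R}^E\to\mathbb{Z}$ is denoted $\mathbf{1}_{\mathscr{P}(\mathsf{M})}$. A map $f$ from matroids to an abelian group is a valuation if $\sum_{i}a_if(\mathsf{M}_i)=0$ whenever $\mathsf{M}_1,\dots,\mathsf{M}_s$ are matroids on a common ground set $E$ and $a_i\in\mathbb{Z}$ satisfy $\sum_i a_i\mathbf{1}_{\mathscr{P}(\mathsf{M}_i)}=0$. (This is known to be equivalent to the inclusion–exclusion property under matroid subdivisions.) It is an invariant if $f(\mathsf{M})=f(\mathsf{N})$ whenever $\mathsf{M}\cong\mathsf{N}$; a valuative invariant is a valuation that is an invariant. Stressed subsets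 and relaxation: let $\mathsf{M}$ be a matroid on $E$ of rank $k$ with rank function $\operatorname{rk}$ and bases $\mathscr{B}$. A subset $A\subseteq E$ is stressed if both $\mathsf{M}|_A$ and $\mathsf{M}/A$ are uniform. The cover of $A$ is $\operatorname{cover}(A)=\{S\subseteq E: |S|=k,\ |S\cap A|\ge \operatorname{rk}(A)+1\}$. If $A$ is stressed, $\operatorname{Rel}(\mathsf{M},A)$ is the matroid with bases $\mathscr{B}\sqcup\operatorname{cover}(A)$. For $0\le r\le h$, $0\le k-r\le n-h$, $\mathsf{\Lambda}_{r,k,h,n}$ is the relaxation of $\mathsf{U}_{k-r,n-h}\oplus\mathsf{U}_{r,h}$ by the ground set $F$ of the summand $\mathsf{U}_{r,h}$; its bases are the $k$-subsets $B$ of the $n$-element ground set with $|B\cap F|\ge r$, where $|F|=h$. Elementary split matroids: a matroid is connected if it is not a direct sum of two matroids with non-empty ground sets. For a connected matroid $\mathsf{M}$ on $E$, a flacet is a flat $F$ such that $\mathsf{M}|_F$ and $\mathsf{M}/F$ are connected; a flacet $F$ is a split flacet if $0<\operatorname{rk}(F)<|F|$ and $E\smallsetminus F$ contains at least one element that is not a coloop of $\mathsf{M}$. A connected split matroid is a connected matroid all of whose split flacets are stressed. A matroid is elementary split if it is either a connected split matroid or a direct sum of two uniform matroids. *)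

theory Defs
  imports "HOL-Analysis.Analysis" "HOL-Analysis.Finite_Function_Topology"
begin

section \<open>Matroids on finite sets of positive integers\<close>

record set_system =
  ground :: "nat set"
  bases :: "nat set set"

definition matroid :: "set_system \<Rightarrow> bool" where
  "matroid M \<longleftrightarrow>
     finite (ground M) \<and> ground M \<subseteq> {0<..} \<and>
     bases M \<noteq> {} \<and> bases M \<subseteq> Pow (ground M) \<and>
     (\<forall>B\<in>bases M. \<forall>C\<in>bases M. \<forall>x\<in>B - C. \<exists>y\<in>C - B. insert y (B - {x}) \<in> bases M)"

definition rk :: "set_system \<Rightarrow> nat set \<Rightarrow> nat" where
  "rk M A = Max ((\<lambda>B. card (A \<inter> B)) ` bases M)"

definition matroid_rank :: "set_system \<Rightarrow> nat" where
  "matroid_rank M = rk M (ground M)"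

definition matroid_iso :: "set_system \<Rightarrow> set_system \<Rightarrow> bool" where
  "matroid_iso M N \<longleftrightarrow>
     (\<exists>\<phi>. bij_betw \<phi> (ground M) (ground N) \<and> bases N = (\<lambda>B. \<phi> ` B) ` bases M)"

text \<open>The bases of \<open>M|A\<close> are the maximal sets \<open>A \<inter> B\<close>, those of \<open>M/A\<close> the corresponding \<open>B - A\<close>.\<close>

definition restriction :: "set_system \<Rightarrow> nat set \<Rightarrow> set_system" where
  "restriction M A =
     \<lparr>ground = ground M \<inter> A, bases = {A \<inter> B | B. B \<in> bases M \<and> card (A \<inter> B) = rk M A}\<rparr>"

definition contraction :: "set_system \<Rightarrow> nat set \<Rightarrow> set_system" where
  "contraction M A =
     \<lparr>ground = ground M - A, bases = {B - A | B. B \<in> bases M \<and> card (A \<inter> B) = rk M A}\<rparr>"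

text \<open>Only meaningful for matroids on disjoint ground sets.\<close>

definition direct_sum :: "set_system \<Rightarrow> set_system \<Rightarrow> set_system" where
  "direct_sum M N =
     \<lparr>ground = ground M \<union> ground N, bases = {B \<union> C | B C. B \<in> bases M \<and> C \<in> bases N}\<rparr>"

definition uniform_on :: "nat set \<Rightarrow> nat \<Rightarrow> set_system" where
  "uniform_on E k = \<lparr>ground = E, bases = {B. B \<subseteq> E \<and> card B = k}\<rparr>"

definition uniform :: "set_system \<Rightarrow> bool" where
  "uniform M \<longleftrightarrow> (\<exists>k \<le> card (ground M). M = uniform_on (ground M) k)"

definition connected_matroid :: "set_system \<Rightarrow> bool" where
  "connected_matroid M \<longleftrightarrow> matroid M \<and>
     \<not> (\<exists>N1 N2. matroid N1 \<and> matroid N2 \<and> ground N1 \<noteq> {} \<and> ground N2 \<noteq> {} \<and>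
          ground N1 \<inter> ground N2 = {} \<and> M = direct_sum N1 N2)"

definition flat :: "set_system \<Rightarrow> nat set \<Rightarrow> bool" where
  "flat M F \<longleftrightarrow> F \<subseteq> ground M \<and> (\<forall>e \<in> ground M - F. rk M F < rk M (insert e F))"

definition coloop :: "set_system \<Rightarrow> nat \<Rightarrow> bool" where
  "coloop M e \<longleftrightarrow> e \<in> ground M \<and> (\<forall>B \<in> bases M. e \<in> B)"


section \<open>Stressed subsets and relaxation\<close>

definition stressed :: "set_system \<Rightarrow> nat set \<Rightarrow> bool" where
  "stressed M A \<longleftrightarrow> A \<subseteq> ground M \<and> uniform (restriction M A) \<and> uniform (contraction M A)"

definition cover :: "set_system \<Rightarrow> nat set \<Rightarrow> nat set set" where
  "cover M A = {S. S \<subseteq> ground M \<and> card S = matroid_rank M \<and> card (S \<inter> A) \<ge> rk M A + 1}"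

text \<open>Only meaningful (and a matroid) when \<open>A\<close> is stressed in \<open>M\<close>.\<close>

definition relaxation :: "set_system \<Rightarrow> nat set \<Rightarrow> set_system" where
  "relaxation M A = \<lparr>ground = ground M, bases = bases M \<union> cover M A\<rparr>"

definition stressed_count :: "set_system \<Rightarrow> nat \<Rightarrow> nat \<Rightarrow> nat" where
  "stressed_count M r h =
     card {A. stressed M A \<and> cover M A \<noteq> {} \<and> card A = h \<and> rk M A = r}"

text \<open>
  Representatives of the isomorphism classes of \<open>U\<^sub>k\<^sub>,\<^sub>n\<close>, of the direct sum of \<open>U\<^sub>k\<^sub>-\<^sub>r\<^sub>,\<^sub>n\<^sub>-\<^sub>h\<close> and \<open>U\<^sub>r\<^sub>,\<^sub>h\<close>,
  and of its relaxation by the ground set of the second summand.  The latter two are meant for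
  \<open>r \<le> h\<close>, \<open>r \<le> k\<close>, \<open>h \<le> n\<close> and \<open>k - r \<le> n - h\<close>, where the subtractions do not truncate.
\<close>

definition U_matroid :: "nat \<Rightarrow> nat \<Rightarrow> set_system" where
  "U_matroid k n = uniform_on {1..n} k"

definition U_sum :: "nat \<Rightarrow> nat \<Rightarrow> nat \<Rightarrow> nat \<Rightarrow> set_system" where
  "U_sum r k h n = direct_sum (uniform_on {h+1..n} (k - r)) (uniform_on {1..h} r)"

definition Lam :: "nat \<Rightarrow> nat \<Rightarrow> nat \<Rightarrow> nat \<Rightarrow> set_system" where
  "Lam r k h n = relaxation (U_sum r k h n) {1..h}"


section \<open>Elementary split matroids\<close>

definition flacet :: "set_system \<Rightarrow> nat set \<Rightarrow> bool" where
  "flacet M F \<longleftrightarrow> flat M F \<and>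
     connected_matroid (restriction M F) \<and> connected_matroid (contraction M F)"

definition split_flacet :: "set_system \<Rightarrow> nat set \<Rightarrow> bool" where
  "split_flacet M F \<longleftrightarrow> flacet M F \<and> 0 < rk M F \<and> rk M F < card F \<and>
     (\<exists>e \<in> ground M - F. \<not> coloop M e)"

definition connected_split_matroid :: "set_system \<Rightarrow> bool" where
  "connected_split_matroid M \<longleftrightarrow>
     connected_matroid M \<and> (\<forall>F. split_flacet M F \<longrightarrow> stressed M F)"

definition elementary_split :: "set_system \<Rightarrow> bool" where
  "elementary_split M \<longleftrightarrow> connected_split_matroid M \<or>
     (\<exists>N1 N2. matroid N1 \<and> matroid N2 \<and> uniform N1 \<and> uniform N2 \<and>
        ground N1 \<inter> ground N2 = {} \<and> M = direct_sum N1 N2)"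


section \<open>Valuative invariants\<close>

text \<open>
  \<open>\<real>\<^sup>E\<close> for varying finite \<open>E\<close> is realised inside the real vector space of finitely supported
  functions on the natural numbers, as the subspace of functions supported in \<open>E\<close>;
  \<open>Poly_Mapping.single i 1\<close> is the basis vector \<open>e\<^sub>i\<close>.
\<close>

definition coord_space :: "nat set \<Rightarrow> (nat \<Rightarrow>\<^sub>0 real) set" where
  "coord_space E = {x. Poly_Mapping.keys x \<subseteq> E}"

definition base_polytope :: "set_system \<Rightarrow> (nat \<Rightarrow>\<^sub>0 real) set" where
  "base_polytope M = convex hull ((\<lambda>B. \<Sum>i\<in>B. Poly_Mapping.single i 1) ` bases M)"

text \<open>The \<open>\<int>\<close>-module structure of an abelian group; at most one of the two sums is non-empty.\<close>

definition zmult :: "int \<Rightarrow> 'g::ab_group_add \<Rightarrow> 'g" where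
  "zmult a x = (\<Sum>i<nat a. x) - (\<Sum>i<nat (- a). x)"

definition valuation :: "(set_system \<Rightarrow> 'g::ab_group_add) \<Rightarrow> bool" where
  "valuation f \<longleftrightarrow>
     (\<forall>E (s::nat) (Ms :: nat \<Rightarrow> set_system) (a :: nat \<Rightarrow> int).
        (\<forall>i<s. matroid (Ms i) \<and> ground (Ms i) = E) \<longrightarrow>
        (\<forall>x \<in> coord_space E. (\<Sum>i<s. a i * indicator (base_polytope (Ms i)) x) = 0) \<longrightarrow>
        (\<Sum>i<s. zmult (a i) (f (Ms i))) = 0)"

definition matroid_invariant :: "(set_system \<Rightarrow> 'g) \<Rightarrow> bool" where
  "matroid_invariant f \<longleftrightarrow>
     (\<forall>M N. matroid M \<longrightarrow> matroid N \<longrightarrow> matroid_iso M N \<longrightarrow> f M = f N)"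

definition valuative_invariant :: "(set_system \<Rightarrow> 'g::ab_group_add) \<Rightarrow> bool" where
  "valuative_invariant f \<longleftrightarrow> valuation f \<and> matroid_invariant f"

end

theory Submission
  imports Defs
begin

text \<open>
  Write \<open>\<Delta>\<close> for the hypersimplex, the base polytope of the uniform matroid.  A basis of an elementary
  split matroid is a \<open>k\<close>-subset \<open>B\<close> with \<open>|B \<inter> F| \<le> rk F\<close> for every stressed \<open>F\<close> with non-empty cover.
  Two distinct such sets satisfy \<open>k + |F \<inter> G| \<le> rk F + rk G\<close>.  This makes the inequalities
  \<open>x(F) \<le> rk F\<close> cut an integral polytope out of \<open>\<Delta>\<close>, so that it is the base polytope of \<open>M\<close>, and makes
  the removed regions \<open>x(F) > rk F\<close> pairwise disjoint.  The region removed for \<open>F\<close> is the base polytope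
  of a copy of \<open>\<Lambda>\<close> minus that of a copy of the direct sum of two uniform matroids, so the formula is
  the image under \<open>f\<close> of an identity of indicator functions.
\<close>

section \<open>Bases, independent sets and rank\<close>

text \<open>A valuation speaks only of base polytopes of matroids, so every region in the identity
  has to be recognised as one. All of them are the hypersimplex cut by upper bounds
  \<open>x(A) \<le> s\<close>. On it \<open>x(E - F) \<le> k - r\<close> is the lower bound
  \<open>x(F) \<ge> r\<close>; together with \<open>x(F) \<le> r\<close> this gives the direct sum,
  and alone it gives its relaxation. One exchange and integrality theorem, under the hypothesis
  \<open>spread\<close>, therefore serves \<open>M\<close>, the uniform matroid and both kinds of
  correction term.

  That \<open>M\<close> itself has this form needs a reason for each \<open>k\<close>-subset
  \<open>B\<close> that is not a basis. If \<open>M\<close> is connected, an extremal set on which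
  \<open>B\<close> exceeds the rank is a split flacet, hence stressed by hypothesis, and
  \<open>B\<close> lies in its cover. A direct sum of two uniform matroids need not be connected and
  is treated separately, with its two ground sets as the stressed sets.

  The inequality for two stressed sets \<open>F\<close>, \<open>G\<close> is submodularity of the
  rank: uniformity of \<open>M|F\<close> makes \<open>F \<inter> G\<close> independent, and
  uniformity of \<open>M/F\<close> makes \<open>F \<union> G\<close> spanning.\<close>

definition indep :: "set_system \<Rightarrow> nat set \<Rightarrow> bool" where
  "indep M I \<longleftrightarrow> (\<exists>B\<in>bases M. I \<subseteq> B)"

lemma card_swap:
  assumes "finite B" "x \<in> B" "y \<notin> B"
  shows "card (insert y (B - {x})) = card B"
proof -
  have "card (insert y (B - {x})) = Suc (card (B - {x}))"
    using assms by (intro card_insert_disjoint) auto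
  also have "\<dots> = card B" using assms by (intro card_Suc_Diff1) auto
  finally show ?thesis .
qed

context
  fixes M :: set_system
  assumes matroid: "matroid M"
begin

lemma finite_ground: "finite (ground M)"
  using matroid by (simp add: matroid_def)

lemma base_subset: "B \<in> bases M \<Longrightarrow> B \<subseteq> ground M"
  using matroid by (auto simp: matroid_def)

lemma finite_base: "B \<in> bases M \<Longrightarrow> finite B"
  using base_subset finite_ground finite_subset by blast

lemma bases_nonempty: "bases M \<noteq> {}"
  using matroid by (simp add: matroid_def)

lemma finite_bases: "finite (bases M)"
  using matroid by (meson finite_Pow_iff finite_subset matroid_def)

lemma base_exchange:
  "B \<in> bases M \<Longrightarrow> C \<in> bases M \<Longrightarrow> x \<in> B - C \<Longrightarrow> \<exists>y\<in>C - B. insert y (B - {x}) \<in> bases M"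
  using matroid by (simp add: matroid_def)

lemma indep_subset_ground: "indep M I \<Longrightarrow> I \<subseteq> ground M"
  using base_subset by (auto simp: indep_def)

lemma finite_indep: "indep M I \<Longrightarrow> finite I"
  using indep_subset_ground finite_ground finite_subset by blast

lemma indep_subset: "indep M J \<Longrightarrow> I \<subseteq> J \<Longrightarrow> indep M I"
  by (auto simp: indep_def)

lemma base_indep: "B \<in> bases M \<Longrightarrow> indep M B"
  by (auto simp: indep_def)

text \<open>Take a base over \<open>I\<close> that meets \<open>C\<close> in as many elements as
  possible. Exchanging an element outside both \<open>C\<close> and \<open>I\<close> for one of
  \<open>C\<close> would keep \<open>I\<close> and enlarge that intersection.\<close>

lemma ex_base_diff_subset:
  assumes I: "I \<subseteq> B" "B \<in> bases M" and C: "C \<in> bases M"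
  obtains B' where "B' \<in> bases M" "I \<subseteq> B'" "B' - C \<subseteq> I"
proof -
  define S where "S = {B' \<in> bases M. I \<subseteq> B'}"
  have "finite S" "S \<noteq> {}"
    using I finite_bases by (auto simp: S_def)
  then obtain B' where B': "B' \<in> S" and max: "\<And>X. X \<in> S \<Longrightarrow> card (X \<inter> C) \<le> card (B' \<inter> C)"
    by (metis obtains_MAX[of S "\<lambda>X. card (X \<inter> C)"] Max_ge finite_imageI image_eqI)
  have "B' - C \<subseteq> I"
  proof (rule ccontr)
    assume "\<not> B' - C \<subseteq> I"
    then obtain x where x: "x \<in> B' - C" "x \<notin> I" by auto
    then obtain y where y: "y \<in> C - B'" "insert y (B' - {x}) \<in> bases M"
      using base_exchange B' C by (force simp: S_def)
    then have "insert y (B' - {x}) \<in> S" using B' x by (auto simp: S_def)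
    moreover have "insert y (B' - {x}) \<inter> C = insert y (B' \<inter> C)" using x y by auto
    moreover have "finite (B' \<inter> C)" using C finite_base by blast
    ultimately show False using max[of "insert y (B' - {x})"] y by simp
  qed
  then show thesis using that B' by (auto simp: S_def)
qed

text \<open>Each exchange towards \<open>C\<close> preserves the cardinality and shrinks
  \<open>B - C\<close>, until \<open>B\<close> lies inside \<open>C\<close>. By symmetry all bases
  have the same size.\<close>

lemma card_base_le: 
  assumes "B \<in> bases M" "C \<in> bases M" shows "card B \<le> card C"
  using assms
proof (induction "card (B - C)" arbitrary: B rule: less_induct)
  case (less B)
  show ?case
  proof (cases "B \<subseteq> C")
    case True
    then show ?thesis using less.prems finite_base by (simp add: card_mono)
  next
    case False
    then obtain x where x: "x \<in> B - C" by auto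
    then obtain y where y: "y \<in> C - B" "insert y (B - {x}) \<in> bases M"
      using base_exchange less.prems by blast
    have fin: "finite B" using less.prems finite_base by blast
    have "insert y (B - {x}) - C = (B - C) - {x}" using y by auto
    then have "card (insert y (B - {x}) - C) < card (B - C)"
      using x fin by (metis card_Diff1_less finite_Diff)
    then have "card (insert y (B - {x})) \<le> card C" using less y by blast
    moreover have "card (insert y (B - {x})) = card B"
      using x y fin by (intro card_swap) auto
    ultimately show ?thesis by simp
  qed
qed

text \<open>Extend \<open>I\<close> to a base \<open>B'\<close> inside \<open>I \<union> C\<close>,
  where \<open>C\<close> is a base over \<open>J\<close>. If \<open>B'\<close> missed
  \<open>J - I\<close>, then \<open>J - I\<close> would lie in \<open>C - B'\<close>, which is as
  large as \<open>B' - C\<close>, a subset of \<open>I - J\<close>; this contradicts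
  \<open>card I < card J\<close>.\<close>

lemma augment:
  assumes I: "indep M I" and J: "indep M J" and less: "card I < card J"
  obtains x where "x \<in> J - I" "indep M (insert x I)"
proof -
  obtain B C where BC: "B \<in> bases M" "I \<subseteq> B" "C \<in> bases M" "J \<subseteq> C"
    using I J by (auto simp: indep_def)
  obtain B' where B': "B' \<in> bases M" "I \<subseteq> B'" "B' - C \<subseteq> I"
    using ex_base_diff_subset BC by metis
  have "B' \<inter> (J - I) \<noteq> {}"
  proof
    assume disj: "B' \<inter> (J - I) = {}"
    have fin: "finite B'" "finite C" "finite I" "finite J"
      using B' BC finite_base I J finite_indep by auto
    have "card B' = card C" using card_base_le B' BC by (meson le_antisym)
    then have "card (C - B') = card (B' - C)"
      using fin by (simp add: card_le_sym_Diff le_antisym)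
    moreover have "card (J - I) \<le> card (C - B')"
      using disj BC fin by (intro card_mono) auto
    moreover have "card (B' - C) \<le> card (I - J)"
      using B' BC fin by (intro card_mono) auto
    ultimately have "card (J - I) \<le> card (I - J)" by simp
    then show False using less fin
      by (metis card_less_sym_Diff leD)
  qed
  then obtain x where "x \<in> B'" "x \<in> J - I" by auto
  then show thesis using that B' by (auto simp: indep_def)
qed

lemma card_le_rk: "B \<in> bases M \<Longrightarrow> card (A \<inter> B) \<le> rk M A"
  unfolding rk_def using finite_bases by (intro Max_ge) auto

lemma ex_base_card_rk: obtains B where "B \<in> bases M" "card (A \<inter> B) = rk M A"
proof -
  have "rk M A \<in> (\<lambda>B. card (A \<inter> B)) ` bases M"
    unfolding rk_def using finite_bases bases_nonempty by (intro Max_in) auto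
  then show thesis using that by auto
qed

lemma indep_card_le_rk:
  assumes "indep M I" "I \<subseteq> A" shows "card I \<le> rk M A"
proof -
  obtain B where B: "B \<in> bases M" "I \<subseteq> B" using assms by (auto simp: indep_def)
  then have "card I \<le> card (A \<inter> B)" using assms finite_base by (intro card_mono) auto
  then show ?thesis using card_le_rk[OF B(1)] order_trans by blast
qed

lemma indep_extend:
  assumes "indep M I" "I \<subseteq> A"
  obtains J where "indep M J" "I \<subseteq> J" "J \<subseteq> A" "card J = rk M A"
proof -
  define S where "S = {J. indep M J \<and> I \<subseteq> J \<and> J \<subseteq> A}"
  have "finite S"
    using finite_ground indep_subset_ground by (intro finite_subset[of S "Pow (ground M)"]) (auto simp: S_def)
  moreover have "S \<noteq> {}" using assms by (auto simp: S_def)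
  ultimately obtain J where J: "J \<in> S" and max: "\<And>X. X \<in> S \<Longrightarrow> card X \<le> card J"
    by (metis obtains_MAX[of S card] Max_ge finite_imageI image_eqI)
  have J': "indep M J" "I \<subseteq> J" "J \<subseteq> A" using J by (auto simp: S_def)
  have "card J = rk M A"
  proof (rule ccontr)
    assume "card J \<noteq> rk M A"
    then have lt: "card J < rk M A" using indep_card_le_rk[OF J'(1,3)] by simp
    obtain B where B: "B \<in> bases M" "card (A \<inter> B) = rk M A" using ex_base_card_rk .
    have "indep M (A \<inter> B)" using B by (auto simp: indep_def)
    then obtain x where x: "x \<in> (A \<inter> B) - J" "indep M (insert x J)"
      using augment[OF J'(1), of "A \<inter> B"] lt B by auto
    then have "insert x J \<in> S" using J' by (auto simp: S_def)
    then show False using max[of "insert x J"] x finite_indep[OF J'(1)] by simp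
  qed
  then show thesis using that J' by blast
qed

lemma rk_mono: "A \<subseteq> B \<Longrightarrow> rk M A \<le> rk M B"
  by (metis ex_base_card_rk[of A] base_indep indep_card_le_rk indep_subset inf_le1 inf_le2 order_trans)

text \<open>Extend a maximal independent subset of \<open>A \<inter> B\<close> to one of
  \<open>A \<union> B\<close> and count the latter inside \<open>A\<close> and inside
  \<open>B\<close>: the part in the intersection is counted twice.\<close>

lemma rk_submodular: "rk M (A \<union> B) + rk M (A \<inter> B) \<le> rk M A + rk M B"
proof -
  have "indep M {}" using bases_nonempty by (auto simp: indep_def)
  then obtain I where I: "indep M I" "I \<subseteq> A \<inter> B" "card I = rk M (A \<inter> B)"
    using indep_extend[of "{}" "A \<inter> B"] by auto
  then obtain J where J: "indep M J" "I \<subseteq> J" "J \<subseteq> A \<union> B" "card J = rk M (A \<union> B)"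
    using indep_extend[of I "A \<union> B"] by blast
  have fin: "finite J" using J finite_indep by blast
  have "card (J \<inter> A) + card (J \<inter> B) = card ((J \<inter> A) \<union> (J \<inter> B)) + card ((J \<inter> A) \<inter> (J \<inter> B))"
    using fin by (intro card_Un_Int) auto
  moreover have "(J \<inter> A) \<union> (J \<inter> B) = J" using J by auto
  moreover have "card I \<le> card ((J \<inter> A) \<inter> (J \<inter> B))" using fin I J by (intro card_mono) auto
  moreover have "card (J \<inter> A) \<le> rk M A" "card (J \<inter> B) \<le> rk M B"
    using J by (auto intro!: indep_card_le_rk intro: indep_subset)
  ultimately show ?thesis using I J by simp
qed

lemma rk_le_card: "finite A \<Longrightarrow> rk M A \<le> card A"
  by (metis card_mono ex_base_card_rk inf_le1)

lemma rk_empty: "rk M {} = 0"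
  using rk_le_card[of "{}"] by simp

lemma card_base: "B \<in> bases M \<Longrightarrow> card B = matroid_rank M"
  by (metis base_subset card_base_le ex_base_card_rk inf.absorb2 le_antisym matroid_rank_def)

lemma base_iff: "B \<in> bases M \<longleftrightarrow> indep M B \<and> card B = matroid_rank M"
proof
  assume *: "indep M B \<and> card B = matroid_rank M"
  then obtain C where "C \<in> bases M" "B \<subseteq> C" by (auto simp: indep_def)
  then show "B \<in> bases M" using * card_base[of C] finite_base[of C] by (metis card_subset_eq)
qed (simp add: base_indep card_base)

lemma indep_iff_rk: "finite I \<Longrightarrow> indep M I \<longleftrightarrow> rk M I = card I"
proof
  assume fin: "finite I"
  show "indep M I \<Longrightarrow> rk M I = card I"
    using indep_card_le_rk rk_le_card fin by (simp add: le_antisym)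
  assume "rk M I = card I"
  then obtain B where "B \<in> bases M" "card (I \<inter> B) = card I" using ex_base_card_rk by metis
  then show "indep M I" using fin card_subset_eq[of I "I \<inter> B"] by (auto simp: indep_def)
qed

text \<open>A pair \<open>U\<close>, \<open>V\<close> with equality in submodularity separates the
  minor \<open>(M|(U \<union> V))/(U \<inter> V)\<close>, and the rank of every intermediate set
  splits along it. Submodularity for \<open>X, U\<close> and for \<open>X \<union> U, V\<close> adds
  up, by the equality, to one direction; submodularity for \<open>X \<inter> U, X \<inter> V\<close>
  is the other.\<close>

lemma rk_separation:
  assumes "rk M U + rk M V = rk M (U \<inter> V) + rk M (U \<union> V)" "U \<inter> V \<subseteq> X" "X \<subseteq> U \<union> V"
  shows "rk M X + rk M (U \<inter> V) = rk M (X \<inter> U) + rk M (X \<inter> V)"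
proof -
  have "rk M ((X \<union> U) \<union> V) + rk M ((X \<union> U) \<inter> V) \<le> rk M (X \<union> U) + rk M V"
    by (rule rk_submodular)
  moreover have "(X \<union> U) \<union> V = U \<union> V" "(X \<union> U) \<inter> V = X \<inter> V" using assms by auto
  moreover have "rk M ((X \<inter> U) \<union> (X \<inter> V)) + rk M ((X \<inter> U) \<inter> (X \<inter> V)) \<le> rk M (X \<inter> U) + rk M (X \<inter> V)"
    by (rule rk_submodular)
  moreover have "(X \<inter> U) \<union> (X \<inter> V) = X" "(X \<inter> U) \<inter> (X \<inter> V) = U \<inter> V" using assms by auto
  ultimately show ?thesis using rk_submodular[of X U] assms(1) by simp
qed

section \<open>Restriction and contraction as matroids, with their rank functions\<close>

lemma restriction_base_iff:
  assumes "A \<subseteq> ground M"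
  shows "X \<in> bases (restriction M A) \<longleftrightarrow> X \<subseteq> A \<and> indep M X \<and> card X = rk M A"
proof
  assume X: "X \<subseteq> A \<and> indep M X \<and> card X = rk M A"
  then obtain B where B: "B \<in> bases M" "X \<subseteq> B" by (auto simp: indep_def)
  then have "X \<subseteq> A \<inter> B" "finite (A \<inter> B)" using X finite_base by auto
  then have "X = A \<inter> B" using X card_le_rk[OF B(1), of A]
    by (simp add: card_seteq)
  then show "X \<in> bases (restriction M A)" using B X by (auto simp: restriction_def)
qed (auto simp: restriction_def indep_def)

lemma matroid_restriction:
  assumes A: "A \<subseteq> ground M" shows "matroid (restriction M A)"
proof -
  have "\<exists>y\<in>Y - X. insert y (X - {x}) \<in> bases (restriction M A)"
    if X: "X \<in> bases (restriction M A)" and Y: "Y \<in> bases (restriction M A)" and x: "x \<in> X - Y" for X Y x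
  proof -
    note X' = X[unfolded restriction_base_iff[OF A]] and Y' = Y[unfolded restriction_base_iff[OF A]]
    have fin: "finite X" using X' finite_indep by blast
    have "indep M (X - {x})" using X' indep_subset by blast
    moreover have "card (X - {x}) < card Y" using x fin X' Y' by (metis DiffD1 card_Diff1_less)
    ultimately obtain y where y: "y \<in> Y - (X - {x})" "indep M (insert y (X - {x}))"
      using augment Y' by blast
    then have "y \<in> Y - X" using x by auto
    moreover have "card (insert y (X - {x})) = card X"
      using x y fin by (intro card_swap) auto
    ultimately show ?thesis using y X' Y' by (auto simp: restriction_base_iff[OF A])
  qed
  moreover have "bases (restriction M A) \<noteq> {}"
    using ex_base_card_rk[of A] by (auto simp: restriction_def)
  ultimately show ?thesis using matroid A
    by (auto simp: matroid_def restriction_def)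
qed

lemma rk_restriction:
  assumes "A \<subseteq> ground M" "X \<subseteq> A" shows "rk (restriction M A) X = rk M X"
proof (rule antisym)
  have mr: "matroid (restriction M A)" using matroid_restriction assms by blast
  have fin: "finite (bases (restriction M A))"
    using mr by (meson finite_Pow_iff finite_subset matroid_def)
  have "card (X \<inter> B) \<le> rk M X" if "B \<in> bases (restriction M A)" for B
    using that by (auto simp: restriction_base_iff[OF assms(1)] intro!: indep_card_le_rk intro: indep_subset)
  moreover have ne: "bases (restriction M A) \<noteq> {}" using mr by (simp add: matroid_def)
  ultimately show "rk (restriction M A) X \<le> rk M X"
    using fin by (simp add: rk_def[of "restriction M A"])
  obtain B where B: "B \<in> bases M" "card (X \<inter> B) = rk M X" using ex_base_card_rk .
  obtain J where J: "indep M J" "X \<inter> B \<subseteq> J" "J \<subseteq> A" "card J = rk M A"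
    using indep_extend[of "X \<inter> B" A] B assms by (auto simp: indep_def)
  then have "J \<in> bases (restriction M A)" by (simp add: restriction_base_iff[OF assms(1)])
  moreover have "rk M X \<le> card (X \<inter> J)"
    using B J finite_indep by (metis card_mono finite_Int inf.boundedI inf_le1)
  ultimately show "rk M X \<le> rk (restriction M A) X"
    unfolding rk_def[of "restriction M A"] using fin by (meson Max_ge finite_imageI image_eqI order_trans)
qed

text \<open>Extend \<open>A \<inter> B\<close> to a maximal independent subset of
  \<open>(A \<inter> B) \<union> B'\<close>. Nothing more of \<open>A\<close> can enter, because
  \<open>A \<inter> B\<close> already has the rank of \<open>A\<close>; reaching the size of a base
  thus takes all of \<open>B' - A\<close>. So the bases of \<open>M/A\<close> do not depend on the
  part chosen inside \<open>A\<close>.\<close>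

lemma base_swap_inside:
  assumes B: "B \<in> bases M" "card (A \<inter> B) = rk M A" and B': "B' \<in> bases M" "card (A \<inter> B') = rk M A"
  shows "(A \<inter> B) \<union> (B' - A) \<in> bases M"
proof -
  obtain J where J: "indep M J" "A \<inter> B \<subseteq> J" "J \<subseteq> (A \<inter> B) \<union> B'"
      "card J = rk M ((A \<inter> B) \<union> B')"
    using indep_extend[of "A \<inter> B" "(A \<inter> B) \<union> B'"] B by (auto simp: indep_def)
  have fin: "finite J" "finite B" "finite B'" using J finite_indep B B' finite_base by auto
  have "card (A \<inter> J) \<le> rk M A" using J by (auto intro!: indep_card_le_rk intro: indep_subset)
  then have "A \<inter> J = A \<inter> B" using J B fin
    by (metis Int_lower1 card_seteq finite_Int le_inf_iff)
  then have sub: "J \<subseteq> (A \<inter> B) \<union> (B' - A)" using J by auto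
  have "card ((A \<inter> B) \<union> (B' - A)) = card (A \<inter> B) + card (B' - A)"
    using fin by (intro card_Un_disjoint) auto
  also have "\<dots> = card B'" using B B' fin
    by (metis add.commute card_Diff_subset_Int card_mono finite_Int inf_commute inf_le2 le_add_diff_inverse2)
  finally have c: "card ((A \<inter> B) \<union> (B' - A)) = matroid_rank M" using B' card_base by simp
  moreover have "matroid_rank M \<le> card J"
    using J(4) rk_mono[of B' "(A \<inter> B) \<union> B'"] indep_iff_rk[of B'] base_indep[of B'] B' fin card_base by simp
  ultimately have "J = (A \<inter> B) \<union> (B' - A)"
    using sub fin by (intro card_seteq) auto
  then show ?thesis using J c by (simp add: base_iff)
qed

lemma matroid_contraction: "matroid (contraction M A)"
proof -
  have "\<exists>y\<in>Y - X. insert y (X - {x}) \<in> bases (contraction M A)"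
    if X: "X \<in> bases (contraction M A)" and Y: "Y \<in> bases (contraction M A)" and x: "x \<in> X - Y" for X Y x
  proof -
    obtain B where B: "B \<in> bases M" "card (A \<inter> B) = rk M A" "X = B - A"
      using X by (auto simp: contraction_def)
    obtain C where C: "C \<in> bases M" "card (A \<inter> C) = rk M A" "Y = C - A"
      using Y by (auto simp: contraction_def)
    \<comment> \<open>Giving both bases the same part inside \<open>A\<close> forces the exchange to
      take place outside \<open>A\<close>.\<close>
    have D: "(A \<inter> B) \<union> Y \<in> bases M" using base_swap_inside B C by blast
    moreover have "x \<in> B - ((A \<inter> B) \<union> Y)" using x B by auto
    ultimately obtain y where y: "y \<in> ((A \<inter> B) \<union> Y) - B" "insert y (B - {x}) \<in> bases M"
      using base_exchange B by metis
    have y': "y \<in> Y - X" "y \<notin> A" using y B C by auto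
    have "A \<inter> insert y (B - {x}) = A \<inter> B" using y' x B by auto
    moreover have "insert y (B - {x}) - A = insert y (X - {x})" using y' B by auto
    ultimately have "insert y (X - {x}) \<in> bases (contraction M A)"
      using y(2) B(2) unfolding contraction_def by (metis (mono_tags, lifting) mem_Collect_eq set_system.select_convs(2))
    then show ?thesis using y' by blast
  qed
  moreover have "bases (contraction M A) \<noteq> {}"
    using ex_base_card_rk[of A] by (auto simp: contraction_def)
  ultimately show ?thesis using matroid
    by (auto simp: matroid_def contraction_def)
qed

lemma rk_contraction:
  assumes "X \<subseteq> ground M - A" shows "rk (contraction M A) X + rk M A = rk M (A \<union> X)"
proof (rule antisym)
  have mr: "matroid (contraction M A)" by (rule matroid_contraction)
  have fin: "finite (bases (contraction M A))"
    using mr by (meson finite_Pow_iff finite_subset matroid_def)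
  have "rk (contraction M A) X \<in> (\<lambda>B. card (X \<inter> B)) ` bases (contraction M A)"
    unfolding rk_def using fin mr by (intro Max_in) (auto simp: matroid_def)
  then obtain B where B: "B \<in> bases M" "card (A \<inter> B) = rk M A" "rk (contraction M A) X = card (X \<inter> (B - A))"
    by (auto simp: contraction_def)
  have "card (X \<inter> (B - A)) + card (A \<inter> B) = card ((X \<inter> (B - A)) \<union> (A \<inter> B))"
    using finite_base B by (subst card_Un_disjoint) auto
  also have "\<dots> \<le> rk M (A \<union> X)"
    using B by (intro indep_card_le_rk) (auto simp: indep_def)
  finally show "rk (contraction M A) X + rk M A \<le> rk M (A \<union> X)" using B by simp
  obtain B0 where B0: "B0 \<in> bases M" "card (A \<inter> B0) = rk M A" using ex_base_card_rk .
  obtain J where J: "indep M J" "A \<inter> B0 \<subseteq> J" "J \<subseteq> A \<union> X" "card J = rk M (A \<union> X)"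
    using indep_extend[of "A \<inter> B0" "A \<union> X"] B0 by (auto simp: indep_def)
  obtain B1 where B1: "B1 \<in> bases M" "J \<subseteq> B1" using J by (auto simp: indep_def)
  have fin1: "finite B1" "finite B0" using B1 B0 finite_base by auto
  have c1: "card (A \<inter> B1) = rk M A"
    using card_le_rk[OF B1(1), of A] B0(2) card_mono[of "A \<inter> B1" "A \<inter> B0"] J B1 fin1 by force
  then have "B1 - A \<in> bases (contraction M A)" using B1 by (auto simp: contraction_def)
  then have "card (X \<inter> (B1 - A)) \<le> rk (contraction M A) X"
    unfolding rk_def using fin by (intro Max_ge) auto
  moreover have "card J \<le> card ((X \<inter> (B1 - A)) \<union> (A \<inter> B1))"
    using J B1 fin1 by (intro card_mono) auto
  moreover have "\<dots> \<le> card (X \<inter> (B1 - A)) + card (A \<inter> B1)" by (rule card_Un_le)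
  ultimately show "rk M (A \<union> X) \<le> rk (contraction M A) X + rk M A" using J c1 by linarith
qed

end

section \<open>Polytopes cut out of the hypersimplex\<close>

definition constrained :: "nat set \<Rightarrow> nat \<Rightarrow> (nat set \<times> nat) set \<Rightarrow> set_system" where
  "constrained E k \<A> =
     \<lparr>ground = E, bases = {B. B \<subseteq> E \<and> card B = k \<and> (\<forall>(A, s)\<in>\<A>. card (B \<inter> A) \<le> s)}\<rparr>"

text \<open>
  This inequality makes two constraints that are both tight at a point \<open>x\<close> of the hypersimplex
  force \<open>x = 1\<close> on \<open>A \<inter> A'\<close> and \<open>x = 0\<close> off \<open>A \<union> A'\<close>.  Hence the fractional coordinates of \<open>x\<close> see
  the tight constraints as disjoint sets, which gives both the exchange axiom and integrality.
\<close>

definition spread :: "nat set \<Rightarrow> nat \<Rightarrow> (nat set \<times> nat) set \<Rightarrow> bool" where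
  "spread E k \<A> \<longleftrightarrow> finite \<A> \<and> (\<forall>(A, s)\<in>\<A>. A \<subseteq> E) \<and>
     (\<forall>(A, s)\<in>\<A>. \<forall>(A', s')\<in>\<A>. (A, s) \<noteq> (A', s') \<longrightarrow> k + card (A \<inter> A') \<le> s + s')"

lemma spread_subset: "spread E k \<A> \<Longrightarrow> (A, s) \<in> \<A> \<Longrightarrow> A \<subseteq> E"
  unfolding spread_def by fast

lemma spread_pair:
  assumes "spread E k \<A>" "(A, s) \<in> \<A>" "(A', s') \<in> \<A>" "(A, s) \<noteq> (A', s')"
  shows "k + card (A \<inter> A') \<le> s + s'"
proof -
  have "\<forall>(A, s)\<in>\<A>. \<forall>(A', s')\<in>\<A>. (A, s) \<noteq> (A', s') \<longrightarrow> k + card (A \<inter> A') \<le> s + s'"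
    using assms(1) unfolding spread_def by (elim conjE)
  from bspec[OF this assms(2)] have "\<forall>(A', s')\<in>\<A>. (A, s) \<noteq> (A', s') \<longrightarrow> k + card (A \<inter> A') \<le> s + s'"
    by (simp only: prod.case)
  from bspec[OF this assms(3)] show ?thesis using assms(4) by (simp only: prod.case simp_thms)
qed

text \<open>The sum of \<open>x\<close> off \<open>A \<union> A'\<close> plus the sum of
  \<open>1 - x\<close> over \<open>A \<inter> A'\<close> equals
  \<open>k + card (A \<inter> A') - s - s'\<close>, which \<open>spread\<close> makes nonpositive.
  All terms are nonnegative, so each vanishes.\<close>

lemma spread_tight_pair:
  fixes x :: "nat \<Rightarrow> real"
  assumes "finite E" and spread: "spread E k \<A>" and x: "\<And>i. i \<in> E \<Longrightarrow> 0 \<le> x i \<and> x i \<le> 1"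
    and sum: "sum x E = real k"
    and A: "(A, s) \<in> \<A>" "sum x A = real s" and A': "(A', s') \<in> \<A>" "sum x A' = real s'"
    and ne: "(A, s) \<noteq> (A', s')"
  shows "i \<in> A \<Longrightarrow> i \<in> A' \<Longrightarrow> x i = 1" and "i \<in> E \<Longrightarrow> i \<notin> A \<Longrightarrow> i \<notin> A' \<Longrightarrow> x i = 0"
proof -
  have sub: "A \<subseteq> E" "A' \<subseteq> E" and le: "k + card (A \<inter> A') \<le> s + s'"
    using spread_subset[OF spread] spread_pair[OF spread] A A' ne by simp_all
  have fin: "finite A" "finite A'" using sub assms(1) finite_subset by auto
  have "sum x E = sum x (A \<union> A') + sum x (E - (A \<union> A'))"
    using sub assms(1) sum.subset_diff[of "A \<union> A'" E x] by (simp add: add.commute)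
  moreover have "sum x (A \<union> A') + sum x (A \<inter> A') = sum x A + sum x A'"
    using fin by (rule sum.union_inter)
  moreover have "(\<Sum>i\<in>A \<inter> A'. 1 - x i) = card (A \<inter> A') - sum x (A \<inter> A')"
    by (simp add: sum_subtractf)
  moreover have "real k + card (A \<inter> A') \<le> real s + real s'" using le by linarith
  ultimately have le0: "sum x (E - (A \<union> A')) + (\<Sum>i\<in>A \<inter> A'. 1 - x i) \<le> 0"
    using sum A A' by linarith
  have "sum x (E - (A \<union> A')) \<ge> 0" by (rule sum_nonneg) (use x in auto)
  moreover have "(\<Sum>i\<in>A \<inter> A'. 1 - x i) \<ge> 0" by (rule sum_nonneg) (use x sub in auto)
  ultimately have z: "sum x (E - (A \<union> A')) = 0" "(\<Sum>i\<in>A \<inter> A'. 1 - x i) = 0"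
    using le0 by linarith+
  have "\<forall>i\<in>E - (A \<union> A'). x i = 0"
    using z(1) assms(1) x by (subst (asm) sum_nonneg_eq_0_iff) auto
  moreover have "\<forall>i\<in>A \<inter> A'. 1 - x i = 0"
    using z(2) fin x sub by (subst (asm) sum_nonneg_eq_0_iff) auto
  ultimately show "i \<in> A \<Longrightarrow> i \<in> A' \<Longrightarrow> x i = 1" "i \<in> E \<Longrightarrow> i \<notin> A \<Longrightarrow> i \<notin> A' \<Longrightarrow> x i = 0"
    by auto
qed

lemma sum_of_bool_mem: "finite A \<Longrightarrow> (\<Sum>l\<in>A. of_bool (l \<in> B) :: real) = real (card (B \<inter> A))"
  by (simp add: of_bool_def sum.If_cases Int_commute)

text \<open>If \<open>x\<close> cannot be exchanged, every \<open>y\<close> in \<open>C - B\<close>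
  is blocked by a constraint that is tight at \<open>B\<close>, contains \<open>y\<close> and misses
  \<open>x\<close>. Two different blocking constraints would force the coordinate of
  \<open>B\<close> at \<open>x\<close> to be 0, although \<open>x\<close> lies in \<open>B\<close>.
  So one set \<open>A\<close> contains all of \<open>C - B\<close> and misses \<open>x\<close>.
  Passing from \<open>B\<close> to \<open>C\<close> then adds \<open>card (C - B)\<close> elements
  to \<open>A\<close> and removes strictly fewer, so \<open>C\<close> violates the bound that
  \<open>B\<close> attains.\<close>

lemma matroid_constrained:
  assumes fin: "finite E" and pos: "E \<subseteq> {0<..}" and spread: "spread E k \<A>"
    and ne: "bases (constrained E k \<A>) \<noteq> {}"
  shows "matroid (constrained E k \<A>)"
proof -
  have "\<exists>y\<in>C - B. insert y (B - {x}) \<in> bases (constrained E k \<A>)"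
    if B: "B \<in> bases (constrained E k \<A>)" and C: "C \<in> bases (constrained E k \<A>)" and x: "x \<in> B - C" for B C x
  proof (rule ccontr)
    assume no: "\<not> ?thesis"
    have finBC: "finite B" "finite C" using B C fin finite_subset by (auto simp: constrained_def)
    have cards: "card B = k" "card C = k" "B \<subseteq> E" "C \<subseteq> E" using B C by (auto simp: constrained_def)
    have swap: "card (insert y (B - {x})) = k" if "y \<in> C - B" for y
      using card_swap[of B x y] x finBC that cards by simp
    have blocked: "\<exists>(A, s)\<in>\<A>. card (B \<inter> A) = s \<and> y \<in> A \<and> x \<notin> A" if y: "y \<in> C - B" for y
    proof -
      have "insert y (B - {x}) \<notin> bases (constrained E k \<A>)" using no y by blast
      then obtain A s where A: "(A, s) \<in> \<A>" "\<not> card (insert y (B - {x}) \<inter> A) \<le> s"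
        using swap[OF y] cards y by (auto simp: constrained_def)
      have le: "card (B \<inter> A) \<le> s" using A(1) B by (auto simp: constrained_def)
      have "y \<in> A"
      proof (rule ccontr)
        assume "y \<notin> A"
        then have "card (insert y (B - {x}) \<inter> A) \<le> card (B \<inter> A)" using finBC by (intro card_mono) auto
        then show False using A le by simp
      qed
      moreover have "x \<notin> A"
      proof
        assume xA: "x \<in> A"
        have "insert y (B - {x}) \<inter> A = insert y ((B \<inter> A) - {x})" using \<open>y \<in> A\<close> by auto
        then have "card (insert y (B - {x}) \<inter> A) = card (B \<inter> A)"
          using card_swap[of "B \<inter> A" x y] xA x y finBC by simp
        then show False using A le by simp
      qed
      moreover have "card (B \<inter> A) = s"
      proof -
        have "insert y (B - {x}) \<inter> A = insert y (B \<inter> A)" using \<open>y \<in> A\<close> \<open>x \<notin> A\<close> by auto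
        then have "card (insert y (B - {x}) \<inter> A) \<le> Suc (card (B \<inter> A))"
          by (simp add: card_insert_le_m1 card_insert_if finBC)
        then show ?thesis using A le by simp
      qed
      ultimately show ?thesis using A by blast
    qed
    have "card (C - B) = card (B - C)" using cards finBC by (simp add: card_le_sym_Diff le_antisym)
    moreover have "card (B - C) \<noteq> 0" using x finBC by auto
    ultimately have "card (C - B) \<noteq> 0" by simp
    then have "C - B \<noteq> {}" by (metis card.empty)
    then obtain y where y: "y \<in> C - B" by blast
    then obtain A s where A: "(A, s) \<in> \<A>" "card (B \<inter> A) = s" "y \<in> A" "x \<notin> A" using blocked by blast
    \<comment> \<open>The 0/1 vector of \<open>B\<close> is a point of the hypersimplex, so that
      \<open>spread_tight_pair\<close> applies to sets as well.\<close>
    let ?x = "\<lambda>l. of_bool (l \<in> B) :: real"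
    have indB: "sum ?x X = card (B \<inter> X)" if "X \<subseteq> E" for X
      using fin that finite_subset[of X E] by (intro sum_of_bool_mem) auto
    have sub: "Y \<subseteq> E" if "(Y, t) \<in> \<A>" for Y t
      by (rule spread_subset[OF spread that])
    have "C - B \<subseteq> A"
    proof
      fix z assume z: "z \<in> C - B"
      obtain A' s' where A': "(A', s') \<in> \<A>" "card (B \<inter> A') = s'" "z \<in> A'" "x \<notin> A'"
        using blocked[OF z] by blast
      have "A = A'"
      proof (rule ccontr)
        assume "A \<noteq> A'"
        then have "?x x = 0"
          using A A' x cards sub indB
          by (intro spread_tight_pair(2)[OF fin spread, of ?x A s A' s'])
             (auto simp: Int_absorb2)
        then show False using x by simp
      qed
      then show "z \<in> A" using A' by simp
    qed
    then have "C \<inter> A = (B \<inter> C \<inter> A) \<union> (C - B)" by auto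
    then have "card (C \<inter> A) = card (B \<inter> C \<inter> A) + card (C - B)"
      using finBC by (metis (no_types, lifting) Diff_disjoint Int_commute card_Un_disjoint finite_Diff finite_Int inf_assoc inf_left_commute inf_bot_right)
    moreover have "card (B \<inter> A) = card (B \<inter> C \<inter> A) + card ((B - C) \<inter> A)"
      using finBC by (subst card_Un_disjoint[symmetric]) (auto intro: arg_cong[of _ _ card])
    moreover have "card ((B - C) \<inter> A) < card (B - C)"
      using finBC x A by (intro psubset_card_mono) auto
    moreover have "card (C - B) = card (B - C)" by fact
    moreover have "card (C \<inter> A) \<le> s" using C A by (auto simp: constrained_def)
    ultimately show False using A by linarith
  qed
  moreover have "ground (constrained E k \<A>) = E" "bases (constrained E k \<A>) \<subseteq> Pow E"
    by (auto simp: constrained_def)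
  ultimately show ?thesis unfolding matroid_def using fin pos ne by simp
qed

section \<open>Integrality of the constrained hypersimplex\<close>

lemma lookup_scaleR: "Poly_Mapping.lookup (r *\<^sub>R x) i = r *\<^sub>R Poly_Mapping.lookup x i" for x :: "'a \<Rightarrow>\<^sub>0 real"
proof -
  have "finite {i. r *\<^sub>R Poly_Mapping.lookup x i \<noteq> 0}"
    using finite_subset[of "{i. r *\<^sub>R Poly_Mapping.lookup x i \<noteq> 0}" "{i. Poly_Mapping.lookup x i \<noteq> 0}"] by auto
  then show ?thesis by (simp add: scaleR_poly_mapping_def)
qed

text \<open>With no constraints this is the hypersimplex itself.\<close>

definition slab :: "nat set \<Rightarrow> nat \<Rightarrow> (nat set \<times> nat) set \<Rightarrow> (nat \<Rightarrow>\<^sub>0 real) set" where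
  "slab E k \<A> = {x \<in> coord_space E. (\<forall>i\<in>E. 0 \<le> Poly_Mapping.lookup x i \<and> Poly_Mapping.lookup x i \<le> 1) \<and>
     sum (Poly_Mapping.lookup x) E = real k \<and> (\<forall>(A, s)\<in>\<A>. sum (Poly_Mapping.lookup x) A \<le> real s)}"

text \<open>Measures how far a point is from being a vertex: both summands shrink as constraints become tight.\<close>

definition slack :: "nat set \<Rightarrow> (nat set \<times> nat) set \<Rightarrow> (nat \<Rightarrow>\<^sub>0 real) \<Rightarrow> nat" where
  "slack E \<A> x = card {i \<in> E. 0 < Poly_Mapping.lookup x i \<and> Poly_Mapping.lookup x i < 1} +
     card {(A, s) \<in> \<A>. sum (Poly_Mapping.lookup x) A < real s}"

lemma coord_space_iff: "x \<in> coord_space E \<longleftrightarrow> (\<forall>i. i \<notin> E \<longrightarrow> Poly_Mapping.lookup x i = 0)"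
  by (auto simp: coord_space_def in_keys_iff)

text \<open>Moving along \<open>e_i - e_j\<close> keeps the total and, since no tight constraint
  separates \<open>i\<close> from \<open>j\<close>, every tight sum. The step \<open>t\<close> is as
  long as possible: coordinate \<open>i\<close> reaches 1, coordinate \<open>j\<close> reaches 0, or
  a slack constraint becomes tight. Each outcome lowers one summand of \<open>slack\<close>, and
  neither summand grows.\<close>

lemma slab_move:
  assumes fin: "finite E" and spread: "spread E k \<A>" and x: "x \<in> slab E k \<A>"
    and ij: "i \<in> E" "j \<in> E" "i \<noteq> j" and xi: "0 < Poly_Mapping.lookup x i" "Poly_Mapping.lookup x i < 1"
    and xj: "0 < Poly_Mapping.lookup x j" "Poly_Mapping.lookup x j < 1"
    and tight: "\<And>A s. (A, s) \<in> \<A> \<Longrightarrow> sum (Poly_Mapping.lookup x) A = real s \<Longrightarrow> i \<in> A \<longleftrightarrow> j \<in> A"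
  shows "\<exists>t>0. x + t *\<^sub>R (Poly_Mapping.single i 1 - Poly_Mapping.single j 1) \<in> slab E k \<A> \<and>
           slack E \<A> (x + t *\<^sub>R (Poly_Mapping.single i 1 - Poly_Mapping.single j 1)) < slack E \<A> x"
proof -
  \<comment> \<open>Along the move only the constraints containing \<open>i\<close> but not
    \<open>j\<close> have a growing sum, so they and the two coordinates limit the step.\<close>
  define G where "G = {(A, s) \<in> \<A>. i \<in> A \<and> j \<notin> A}"
  define C where "C = {1 - Poly_Mapping.lookup x i, Poly_Mapping.lookup x j} \<union> (\<lambda>(A, s). real s - sum (Poly_Mapping.lookup x) A) ` G"
  have finA: "finite \<A>" using spread by (simp add: spread_def)
  have sub: "\<And>A s. (A, s) \<in> \<A> \<Longrightarrow> A \<subseteq> E" by (rule spread_subset[OF spread])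
  have xsl: "x \<in> coord_space E" "\<And>i. i \<in> E \<Longrightarrow> 0 \<le> Poly_Mapping.lookup x i \<and> Poly_Mapping.lookup x i \<le> 1"
    "sum (Poly_Mapping.lookup x) E = real k" "\<And>A s. (A, s) \<in> \<A> \<Longrightarrow> sum (Poly_Mapping.lookup x) A \<le> real s"
    using x by (auto simp: slab_def)
  have "finite G" using finA by (rule rev_finite_subset) (auto simp: G_def)
  then have finC: "finite C" and neC: "C \<noteq> {}" by (auto simp: C_def)
  \<comment> \<open>A constraint in \<open>G\<close> separates \<open>i\<close> from
    \<open>j\<close>, so by \<open>tight\<close> it cannot be tight at \<open>x\<close>.\<close>
  have posC: "c > 0" if c: "c \<in> C" for c
  proof -
    consider "c = 1 - Poly_Mapping.lookup x i" | "c = Poly_Mapping.lookup x j"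
      | A s where "(A, s) \<in> \<A>" "i \<in> A" "j \<notin> A" "c = real s - sum (Poly_Mapping.lookup x) A"
      using c by (auto simp: C_def G_def)
    then show ?thesis
    proof cases
      case 3
      then show ?thesis using xsl(4)[of A s] tight[of A s] by fastforce
    qed (use xi xj in auto)
  qed
  define t where "t = Min C"
  have tC: "t \<in> C" and tmin: "\<And>c. c \<in> C \<Longrightarrow> t \<le> c" and tpos: "t > 0"
    using Min_in[OF finC neC] Min_le[OF finC] posC by (simp_all add: t_def)
  define y where "y = x + t *\<^sub>R (Poly_Mapping.single i 1 - Poly_Mapping.single j 1)"
  have y: "Poly_Mapping.lookup y l = Poly_Mapping.lookup x l + t * (of_bool (l = i) - of_bool (l = j))" for l
    by (auto simp: y_def lookup_add lookup_scaleR lookup_minus lookup_single)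
  have sumy: "sum (Poly_Mapping.lookup y) A = sum (Poly_Mapping.lookup x) A + t * (of_bool (i \<in> A) - of_bool (j \<in> A))"
    if "A \<subseteq> E" for A
  proof -
    have "finite A" using that fin finite_subset by blast
    then show ?thesis
      by (simp add: y sum.distrib sum_distrib_left[symmetric] sum_subtractf of_bool_def sum.delta)
  qed
  have ti: "t \<le> 1 - Poly_Mapping.lookup x i" and tj: "t \<le> Poly_Mapping.lookup x j" using tmin by (auto simp: C_def)
  have tG: "t \<le> real s - sum (Poly_Mapping.lookup x) A" if "(A, s) \<in> \<A>" "i \<in> A" "j \<notin> A" for A s
    using that by (intro tmin) (auto simp: C_def G_def)
  have yslab: "y \<in> slab E k \<A>"
    unfolding slab_def
  proof (intro CollectI conjI ballI)
    show "y \<in> coord_space E" using xsl(1) ij by (auto simp: coord_space_iff y)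
    show "sum (Poly_Mapping.lookup y) E = real k" using sumy[of E] xsl(3) ij by simp
    show "0 \<le> Poly_Mapping.lookup y l" if "l \<in> E" for l using xsl(2)[OF that] tpos tj by (auto simp: y)
    show "Poly_Mapping.lookup y l \<le> 1" if "l \<in> E" for l using xsl(2)[OF that] tpos ti by (auto simp: y)
    show "case p of (A, s) \<Rightarrow> sum (Poly_Mapping.lookup y) A \<le> real s" if "p \<in> \<A>" for p
    proof -
      obtain A s where p: "p = (A, s)" by (cases p)
      have "sum (Poly_Mapping.lookup y) A \<le> real s"
        using that p sub[of A s] sumy[of A] xsl(4)[of A s] tG[of A s] tpos
        by (cases "i \<in> A"; cases "j \<in> A") auto
      then show ?thesis by (simp add: p)
    qed
  qed
  let ?Fx = "{l \<in> E. 0 < Poly_Mapping.lookup x l \<and> Poly_Mapping.lookup x l < 1}" and ?Fy = "{l \<in> E. 0 < Poly_Mapping.lookup y l \<and> Poly_Mapping.lookup y l < 1}"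
  let ?Sx = "{(A, s) \<in> \<A>. sum (Poly_Mapping.lookup x) A < real s}" and ?Sy = "{(A, s) \<in> \<A>. sum (Poly_Mapping.lookup y) A < real s}"
  have F: "?Fy \<subseteq> ?Fx" using xi xj by (auto simp: y split: if_splits)
  have S: "?Sy \<subseteq> ?Sx"
  proof clarify
    fix A s assume A: "(A, s) \<in> \<A>" "sum (Poly_Mapping.lookup y) A < real s"
    show "sum (Poly_Mapping.lookup x) A < real s"
    proof (rule ccontr)
      assume "\<not> sum (Poly_Mapping.lookup x) A < real s"
      then have "sum (Poly_Mapping.lookup x) A = real s" using xsl(4)[OF A(1)] by simp
      then have "sum (Poly_Mapping.lookup y) A = real s" using tight[OF A(1)] sumy sub[OF A(1)] by simp
      then show False using A by simp
    qed
  qed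
  have finFS: "finite ?Fx" "finite ?Sx" using fin finA by (auto intro: rev_finite_subset[of \<A>])
  have "?Fy \<subset> ?Fx \<or> ?Sy \<subset> ?Sx"
  proof -
    consider "t = 1 - Poly_Mapping.lookup x i" | "t = Poly_Mapping.lookup x j"
      | A s where "(A, s) \<in> \<A>" "i \<in> A" "j \<notin> A" "t = real s - sum (Poly_Mapping.lookup x) A"
      using tC by (auto simp: C_def G_def)
    then show ?thesis
    proof cases
      case 1
      then have "i \<notin> ?Fy" using ij by (simp add: y)
      moreover have "i \<in> ?Fx" using xi ij by simp
      ultimately show ?thesis using F by blast
    next
      case 2
      then have "j \<notin> ?Fy" using ij by (simp add: y)
      moreover have "j \<in> ?Fx" using xj ij by simp
      ultimately show ?thesis using F by blast
    next
      case 3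
      then have "(A, s) \<notin> ?Sy" using sumy[OF sub] by simp
      moreover have "(A, s) \<in> ?Sx" using 3 tpos by simp
      ultimately show ?thesis using S by blast
    qed
  qed
  then have "slack E \<A> y < slack E \<A> x"
    unfolding slack_def
    using finFS F S by (metis (no_types, lifting) add_less_le_mono add_le_less_mono card_mono psubset_card_mono)
  then show ?thesis using tpos yslab unfolding y_def by blast
qed

text \<open>Otherwise all remaining terms are 0 or 1, and \<open>x i\<close> is a difference of two
  integers strictly between 0 and 1.\<close>

lemma ex_other_fractional:
  fixes x :: "'a \<Rightarrow> real"
  assumes "finite A" "i \<in> A" "0 < x i" "x i < 1" "sum x A \<in> \<int>" "\<And>l. l \<in> A \<Longrightarrow> 0 \<le> x l \<and> x l \<le> 1"
  shows "\<exists>j\<in>A. j \<noteq> i \<and> 0 < x j \<and> x j < 1"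
proof (rule ccontr)
  assume no: "\<not> ?thesis"
  have "x l \<in> \<int>" if "l \<in> A - {i}" for l
  proof -
    have "x l = 0 \<or> x l = 1" using no assms(6)[of l] that by force
    then show ?thesis by auto
  qed
  then have "sum x (A - {i}) \<in> \<int>" by (intro Ints_sum) auto
  moreover have "x i = sum x A - sum x (A - {i})" using assms by (simp add: sum_diff1)
  ultimately have "x i \<in> \<int>" using assms(5) by (metis Ints_diff)
  then obtain m where "x i = of_int m" by (auto elim: Ints_cases)
  then show False using assms(3,4) by simp
qed

text \<open>The partner is sought in a block with integral sum. If a tight \<open>A\<close> contains
  \<open>i\<close>, take a second fractional coordinate of \<open>A\<close>: other tight sets
  contain neither, since coordinates common to two tight sets equal 1. If tight sets exist but none
  contains \<open>i\<close>, there is exactly one, and its complement serves. With no tight set the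
  whole of \<open>E\<close> serves.\<close>

lemma slab_ex_partner:
  assumes fin: "finite E" and spread: "spread E k \<A>" and x: "x \<in> slab E k \<A>"
    and i: "i \<in> E" "0 < Poly_Mapping.lookup x i" "Poly_Mapping.lookup x i < 1"
  obtains j where "j \<in> E" "j \<noteq> i" "0 < Poly_Mapping.lookup x j" "Poly_Mapping.lookup x j < 1"
    "\<And>A s. (A, s) \<in> \<A> \<Longrightarrow> sum (Poly_Mapping.lookup x) A = real s \<Longrightarrow> i \<in> A \<longleftrightarrow> j \<in> A"
proof -
  have sub: "\<And>A s. (A, s) \<in> \<A> \<Longrightarrow> A \<subseteq> E" by (rule spread_subset[OF spread])
  have xb: "\<And>i. i \<in> E \<Longrightarrow> 0 \<le> Poly_Mapping.lookup x i \<and> Poly_Mapping.lookup x i \<le> 1" and xE: "sum (Poly_Mapping.lookup x) E = real k"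
    using x by (auto simp: slab_def)
  note pair = spread_tight_pair[OF fin spread xb xE]
  show thesis
  proof (cases "\<exists>(A, s)\<in>\<A>. sum (Poly_Mapping.lookup x) A = real s \<and> i \<in> A")
    case True
    then obtain A s where A: "(A, s) \<in> \<A>" "sum (Poly_Mapping.lookup x) A = real s" "i \<in> A" by blast
    have "finite A" using sub A fin finite_subset by blast
    then obtain j where j: "j \<in> A" "j \<noteq> i" "0 < Poly_Mapping.lookup x j" "Poly_Mapping.lookup x j < 1"
      using ex_other_fractional[of A i "Poly_Mapping.lookup x"] A i sub xb by (metis Ints_of_nat subsetD)
    have "i \<in> A' \<longleftrightarrow> j \<in> A'" if A': "(A', s') \<in> \<A>" "sum (Poly_Mapping.lookup x) A' = real s'" for A' s'
    proof (cases "(A, s) = (A', s')")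
      case False
      then show ?thesis
        using pair(1)[OF _ A(1,2) A' False, of i] pair(1)[OF _ A(1,2) A' False, of j] A i j by auto
    qed (use A j in auto)
    then show thesis using that j sub A by blast
  next
    case False
    show thesis
    proof (cases "\<exists>(A, s)\<in>\<A>. sum (Poly_Mapping.lookup x) A = real s")
      case True
      then obtain A s where A: "(A, s) \<in> \<A>" "sum (Poly_Mapping.lookup x) A = real s" by blast
      have iA: "i \<in> E - A" using A False i by auto
      have "sum (Poly_Mapping.lookup x) (E - A) = real k - real s"
        using fin sub[OF A(1)] A xE by (simp add: sum_diff)
      then have "sum (Poly_Mapping.lookup x) (E - A) \<in> \<int>" by simp
      then obtain j where j: "j \<in> E - A" "j \<noteq> i" "0 < Poly_Mapping.lookup x j" "Poly_Mapping.lookup x j < 1"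
        using ex_other_fractional[of "E - A" i "Poly_Mapping.lookup x"] iA i xb fin by auto
      have "i \<in> A' \<longleftrightarrow> j \<in> A'" if A': "(A', s') \<in> \<A>" "sum (Poly_Mapping.lookup x) A' = real s'" for A' s'
      proof (cases "(A, s) = (A', s')")
        case ne: False
        \<comment> \<open>A second tight set also misses \<open>i\<close>, and a coordinate outside
          two distinct tight sets is 0.\<close>
        have "i \<notin> A'" using False A' by auto
        then show ?thesis using pair(2)[OF _ A A' ne, of i] iA i by auto
      qed (use iA j in auto)
      then show thesis using that j by blast
    next
      case none: False
      obtain j where "j \<in> E" "j \<noteq> i" "0 < Poly_Mapping.lookup x j" "Poly_Mapping.lookup x j < 1"
        using ex_other_fractional[of E i "Poly_Mapping.lookup x"] i xb fin xE by auto
      then show thesis using that none by blast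
    qed
  qed
qed

lemma lookup_indicator_sum:
  "finite B \<Longrightarrow> Poly_Mapping.lookup (\<Sum>i\<in>B. Poly_Mapping.single i (1::real)) l = of_bool (l \<in> B)"
  by (simp add: lookup_sum lookup_single when_def sum.delta)

lemma convex_slab: "convex (slab E k \<A>)"
proof (rule convexI)
  fix x y :: "nat \<Rightarrow>\<^sub>0 real" and u v :: real
  assume x: "x \<in> slab E k \<A>" and y: "y \<in> slab E k \<A>" and uv: "0 \<le> u" "0 \<le> v" "u + v = 1"
  have l: "Poly_Mapping.lookup (u *\<^sub>R x + v *\<^sub>R y) = (\<lambda>i. u * Poly_Mapping.lookup x i + v * Poly_Mapping.lookup y i)"
    by (simp add: fun_eq_iff lookup_add lookup_scaleR)
  have s: "sum (Poly_Mapping.lookup (u *\<^sub>R x + v *\<^sub>R y)) A = u * sum (Poly_Mapping.lookup x) A + v * sum (Poly_Mapping.lookup y) A" for A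
    by (simp add: l sum.distrib sum_distrib_left)
  have b: "u * a + v * b \<le> c" if "a \<le> c" "b \<le> c" for a b c :: real
    using that uv convex_bound_le by blast
  show "u *\<^sub>R x + v *\<^sub>R y \<in> slab E k \<A>"
    unfolding slab_def
  proof (intro CollectI conjI ballI)
    show "u *\<^sub>R x + v *\<^sub>R y \<in> coord_space E"
      using x y by (auto simp: slab_def coord_space_iff l)
    show "sum (Poly_Mapping.lookup (u *\<^sub>R x + v *\<^sub>R y)) E = real k"
      using x y uv by (simp add: slab_def s distrib_right[symmetric])
    show "0 \<le> Poly_Mapping.lookup (u *\<^sub>R x + v *\<^sub>R y) i" "Poly_Mapping.lookup (u *\<^sub>R x + v *\<^sub>R y) i \<le> 1" if "i \<in> E" for i
      using x y uv that b[of "Poly_Mapping.lookup x i" 1 "Poly_Mapping.lookup y i"] by (auto simp: slab_def l)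
    show "case p of (A, r) \<Rightarrow> sum (Poly_Mapping.lookup (u *\<^sub>R x + v *\<^sub>R y)) A \<le> real r" if "p \<in> \<A>" for p
      using x y that b by (auto simp: slab_def s split: prod.splits)
  qed
qed

text \<open>A point with a fractional coordinate \<open>i\<close> lies strictly between two points
  of smaller \<open>slack\<close>, reached by moving along \<open>e_i - e_j\<close> and along its
  negative. A point with no fractional coordinate is the vertex of a basis.\<close>

lemma base_polytope_constrained:
  assumes fin: "finite E" and spread: "spread E k \<A>"
  shows "base_polytope (constrained E k \<A>) = slab E k \<A>"
proof
  have sub: "\<And>A s. (A, s) \<in> \<A> \<Longrightarrow> A \<subseteq> E" by (rule spread_subset[OF spread])
  let ?v = "\<lambda>B. \<Sum>i\<in>B. Poly_Mapping.single i (1::real)"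
  have card: "sum (\<lambda>l. of_bool (l \<in> B)) A = real (card (B \<inter> A))" if "A \<subseteq> E" for A B :: "nat set"
    using that fin finite_subset[of A E] by (intro sum_of_bool_mem) auto
  show "base_polytope (constrained E k \<A>) \<subseteq> slab E k \<A>"
    unfolding base_polytope_def
  proof (intro hull_minimal convex_slab image_subsetI)
    fix B assume B: "B \<in> bases (constrained E k \<A>)"
    then have B': "B \<subseteq> E" "card B = k" "\<And>A s. (A, s) \<in> \<A> \<Longrightarrow> card (B \<inter> A) \<le> s" 
      by (auto simp: constrained_def)
    then have v: "Poly_Mapping.lookup (?v B) = (\<lambda>l. of_bool (l \<in> B))"
      using fin finite_subset[of B E] by (intro ext lookup_indicator_sum) auto
    show "?v B \<in> slab E k \<A>"
      using B' card[of _ B] sub by (auto simp: slab_def coord_space_iff v Int_absorb2)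
  qed
  have "x \<in> base_polytope (constrained E k \<A>)" if "x \<in> slab E k \<A>" for x
    using that
  proof (induction "slack E \<A> x" arbitrary: x rule: less_induct)
    case (less x)
    note x = less.prems
    show ?case
    proof (cases "\<exists>i\<in>E. 0 < Poly_Mapping.lookup x i \<and> Poly_Mapping.lookup x i < 1")
      case True
      then obtain i where i: "i \<in> E" "0 < Poly_Mapping.lookup x i" "Poly_Mapping.lookup x i < 1" by blast
      then obtain j where j: "j \<in> E" "j \<noteq> i" "0 < Poly_Mapping.lookup x j" "Poly_Mapping.lookup x j < 1"
        "\<And>A s. (A, s) \<in> \<A> \<Longrightarrow> sum (Poly_Mapping.lookup x) A = real s \<Longrightarrow> i \<in> A \<longleftrightarrow> j \<in> A"
        using slab_ex_partner[OF fin spread x] by metis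
      let ?d = "Poly_Mapping.single i (1::real) - Poly_Mapping.single j 1"
      obtain t where t: "t > 0" "x + t *\<^sub>R ?d \<in> base_polytope (constrained E k \<A>)"
        using slab_move[OF fin spread x i(1) j(1) j(2)[symmetric] i(2,3) j(3,4)] j(5) less.hyps by blast
      obtain u where u: "u > 0" "x + u *\<^sub>R (- ?d) \<in> base_polytope (constrained E k \<A>)"
        using slab_move[OF fin spread x j(1) i(1) j(2) j(3,4) i(2,3)] j(5) less.hyps
        by (metis minus_diff_eq)
      \<comment> \<open>The weights are inverse to the two step lengths, so the displacements
        \<open>t\<close> and \<open>u\<close> in opposite directions cancel.\<close>
      have "(u / (t + u)) *\<^sub>R (x + t *\<^sub>R ?d) + (t / (t + u)) *\<^sub>R (x + u *\<^sub>R (- ?d)) = x"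
      proof -
        have "(u / (t + u)) *\<^sub>R (x + t *\<^sub>R ?d) + (t / (t + u)) *\<^sub>R (x + u *\<^sub>R (- ?d)) =
           (u / (t + u) + t / (t + u)) *\<^sub>R x + (u / (t + u) * t - t / (t + u) * u) *\<^sub>R ?d"
          by (simp only: scaleR_add_right scaleR_add_left scaleR_diff_left scaleR_minus_right scaleR_scaleR) simp
        also have "u / (t + u) + t / (t + u) = 1" using t u by (simp add: add_divide_distrib[symmetric])
        also have "u / (t + u) * t - t / (t + u) * u = 0" by simp
        finally show ?thesis by simp
      qed
      moreover have "(u / (t + u)) *\<^sub>R (x + t *\<^sub>R ?d) + (t / (t + u)) *\<^sub>R (x + u *\<^sub>R (- ?d))
          \<in> base_polytope (constrained E k \<A>)"
        using t u unfolding base_polytope_def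
        by (intro convexD[OF convex_convex_hull]) (auto simp: add_divide_distrib[symmetric])
      ultimately show ?thesis by simp
    next
      case False
      define B where "B = {i \<in> E. Poly_Mapping.lookup x i = 1}"
      have finB: "finite B" using fin by (simp add: B_def)
      have lx: "Poly_Mapping.lookup x = (\<lambda>l. of_bool (l \<in> B))"
      proof
        fix l show "Poly_Mapping.lookup x l = of_bool (l \<in> B)"
          using x False by (cases "l \<in> E") (force simp: slab_def coord_space_iff B_def)+
      qed
      then have "x = ?v B"
        using finB by (intro poly_mapping_eqI) (simp add: lookup_indicator_sum)
      moreover have "B \<in> bases (constrained E k \<A>)"
      proof -
        have "B \<subseteq> E" by (auto simp: B_def)
        moreover from this have "card B = k"
          using x card[of E B] by (simp add: slab_def lx Int_absorb2)
        moreover have "card (B \<inter> A) \<le> s" if "(A, s) \<in> \<A>" for A s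
          using x that card[OF sub[OF that], of B] by (auto simp: slab_def lx)
        ultimately show ?thesis by (auto simp: constrained_def)
      qed
      ultimately show ?thesis unfolding base_polytope_def by (intro hull_inc) auto
    qed
  qed
  then show "slab E k \<A> \<subseteq> base_polytope (constrained E k \<A>)" by blast
qed

section \<open>Connectivity and split flacets\<close>

text \<open>The minor \<open>(M|T)/A\<close> is connected.\<close>

definition sep_free :: "set_system \<Rightarrow> nat set \<Rightarrow> nat set \<Rightarrow> bool" where
  "sep_free M A T \<longleftrightarrow> (\<forall>U V. U \<union> V = T \<longrightarrow> U \<inter> V = A \<longrightarrow>
     rk M U + rk M V = rk M A + rk M T \<longrightarrow> U = A \<or> V = A)"

lemma rk_direct_sum_grounds:
  assumes "matroid N1" "matroid N2" "ground N1 \<inter> ground N2 = {}" "matroid (direct_sum N1 N2)"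
  shows "rk (direct_sum N1 N2) (ground N1) + rk (direct_sum N1 N2) (ground N2) =
    rk (direct_sum N1 N2) (ground N1 \<union> ground N2)"
proof -
  let ?M = "direct_sum N1 N2"
  have ground: "ground ?M = ground N1 \<union> ground N2" by (simp add: direct_sum_def)
  have *: "ground N1 \<inter> B = B1 \<and> ground N2 \<inter> B = B2" if "B = B1 \<union> B2" "B1 \<in> bases N1" "B2 \<in> bases N2" for B B1 B2
    using that base_subset[OF assms(1), of B1] base_subset[OF assms(2), of B2] assms(3) by blast
  obtain B where B: "B \<in> bases ?M" "card (ground N1 \<inter> B) = rk ?M (ground N1)"
    using ex_base_card_rk[OF assms(4)] .
  obtain C where C: "C \<in> bases ?M" "card (ground N2 \<inter> C) = rk ?M (ground N2)"
    using ex_base_card_rk[OF assms(4)] .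
  obtain B1 B2 where B': "B = B1 \<union> B2" "B1 \<in> bases N1" "B2 \<in> bases N2"
    using B(1) by (auto simp: direct_sum_def)
  obtain C1 C2 where C': "C = C1 \<union> C2" "C1 \<in> bases N1" "C2 \<in> bases N2"
    using C(1) by (auto simp: direct_sum_def)
  have "rk ?M (ground N1) = card B1" using B * B' by metis
  moreover have "rk ?M (ground N2) = card B2"
    using C * C' B' card_base[OF assms(2)] by metis
  moreover have "card B = card B1 + card B2"
    using B' * assms finite_base by (metis Int_assoc card_Un_disjoint inf_bot_right inf_commute)
  ultimately show ?thesis using card_base[OF assms(4) B(1)] ground by (simp add: matroid_rank_def)
qed

lemma connected_matroidI:
  assumes "matroid M" "sep_free M {} (ground M)"
  shows "connected_matroid M"
proof -
  have False if N: "matroid N1" "matroid N2" "ground N1 \<noteq> {}" "ground N2 \<noteq> {}"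
    "ground N1 \<inter> ground N2 = {}" "M = direct_sum N1 N2" for N1 N2
  proof -
    have "ground M = ground N1 \<union> ground N2" using N by (simp add: direct_sum_def)
    then show False
      using rk_direct_sum_grounds[OF N(1,2,5)] N assms(2) assms(1) rk_empty[OF assms(1)]
      unfolding sep_free_def by (metis add_0)
  qed
  then show ?thesis using assms(1) unfolding connected_matroid_def by blast
qed

context
  fixes M :: set_system
  assumes matroid: "matroid M"
begin

lemma direct_sum_restrictions:
  assumes U: "U \<union> V = ground M" "U \<inter> V = {}" and rk: "rk M U + rk M V = rk M (ground M)"
  shows "M = direct_sum (restriction M U) (restriction M V)"
proof -
  have sub: "U \<subseteq> ground M" "V \<subseteq> ground M" using U by auto
  have "bases M = {B \<union> C |B C. B \<in> bases (restriction M U) \<and> C \<in> bases (restriction M V)}"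
  proof (intro equalityI subsetI)
    fix B assume B: "B \<in> bases M"
    have eq: "B = (U \<inter> B) \<union> (V \<inter> B)" using base_subset[OF matroid B] U by auto
    have "card B = card (U \<inter> B) + card (V \<inter> B)"
      using finite_base[OF matroid B] U by (subst eq, intro card_Un_disjoint) auto
    then have "card (U \<inter> B) = rk M U" "card (V \<inter> B) = rk M V"
      using card_le_rk[OF matroid B, of U] card_le_rk[OF matroid B, of V] rk card_base[OF matroid B]
      by (simp_all add: matroid_rank_def)
    then have "U \<inter> B \<in> bases (restriction M U)" "V \<inter> B \<in> bases (restriction M V)"
      using B by (auto simp: restriction_def)
    then show "B \<in> {B \<union> C |B C. B \<in> bases (restriction M U) \<and> C \<in> bases (restriction M V)}"
      using eq by blast
  next
    fix X assume "X \<in> {B \<union> C |B C. B \<in> bases (restriction M U) \<and> C \<in> bases (restriction M V)}"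
    then obtain B C where BC: "X = B \<union> C" "B \<in> bases (restriction M U)" "C \<in> bases (restriction M V)"
      by blast
    note B = BC(2)[unfolded restriction_base_iff[OF matroid sub(1)]]
    note C = BC(3)[unfolded restriction_base_iff[OF matroid sub(2)]]
    have fin: "finite B" "finite C" using B C finite_indep[OF matroid] by auto
    have "card X = card B + card C"
      unfolding BC(1) using fin B C U by (intro card_Un_disjoint) auto
    moreover have "rk M X = matroid_rank M"
    proof -
      have rkB: "rk M B = rk M U" and rkC: "rk M C = rk M V"
        using B C fin indep_iff_rk[OF matroid] by auto
      \<comment> \<open>In \<open>U \<union> V\<close>, first \<open>U\<close> is replaced by its
        basis \<open>B\<close>, then \<open>V\<close> by its basis \<open>C\<close>. Submodularity
        shows that neither replacement loses rank, so \<open>B \<union> C\<close> spans.\<close>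
      have "U \<union> (B \<union> V) = ground M" "U \<inter> (B \<union> V) = B" using B U by auto
      then have "rk M (ground M) + rk M B \<le> rk M U + rk M (B \<union> V)"
        using rk_submodular[OF matroid, of U "B \<union> V"] by simp
      moreover have "X \<union> V = B \<union> V" "X \<inter> V = C" using B C U BC(1) by auto
      then have "rk M (B \<union> V) + rk M C \<le> rk M X + rk M V"
        using rk_submodular[OF matroid, of X V] by simp
      moreover have "rk M X \<le> rk M (ground M)"
        using B C U BC(1) by (intro rk_mono[OF matroid]) auto
      ultimately show ?thesis using rkB rkC by (simp add: matroid_rank_def)
    qed
    ultimately show "X \<in> bases M"
      using B C fin rk BC indep_iff_rk[OF matroid, of X] by (simp add: base_iff[OF matroid] matroid_rank_def)
  qed
  moreover have "ground M = ground (restriction M U) \<union> ground (restriction M V)"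
    using U by (auto simp: restriction_def)
  ultimately show ?thesis unfolding direct_sum_def by simp
qed

lemma connected_restrictionI:
  assumes A: "A \<subseteq> ground M" and "sep_free M {} A"
  shows "connected_matroid (restriction M A)"
proof (rule connected_matroidI)
  show "matroid (restriction M A)" using matroid_restriction[OF matroid A] .
  have g: "ground (restriction M A) = A" using A by (auto simp: restriction_def)
  show "sep_free (restriction M A) {} (ground (restriction M A))"
    unfolding sep_free_def g
  proof (intro allI impI)
    fix U V assume *: "U \<union> V = A" "U \<inter> V = {}"
      "rk (restriction M A) U + rk (restriction M A) V = rk (restriction M A) {} + rk (restriction M A) A"
    have "U \<subseteq> A" "V \<subseteq> A" using * by auto
    then show "U = {} \<or> V = {}"
      using * assms(2) by (simp add: sep_free_def rk_restriction[OF matroid A])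
  qed
qed

lemma connected_contractionI:
  assumes A: "A \<subseteq> ground M" and "sep_free M A (ground M)"
  shows "connected_matroid (contraction M A)"
proof (rule connected_matroidI)
  show "matroid (contraction M A)" using matroid_contraction[OF matroid] .
  have g: "ground (contraction M A) = ground M - A" by (auto simp: contraction_def)
  show "sep_free (contraction M A) {} (ground (contraction M A))"
    unfolding sep_free_def g
  proof (intro allI impI)
    fix U V assume *: "U \<union> V = ground M - A" "U \<inter> V = {}"
      "rk (contraction M A) U + rk (contraction M A) V =
       rk (contraction M A) {} + rk (contraction M A) (ground M - A)"
    have r: "rk (contraction M A) X + rk M A = rk M (A \<union> X)" if "X \<subseteq> ground M - A" for X
      using rk_contraction[OF matroid that] .
    have sub: "U \<subseteq> ground M - A" "V \<subseteq> ground M - A" using * by auto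
    have "A \<union> (ground M - A) = ground M" using A by auto
    then have "rk M (A \<union> U) + rk M (A \<union> V) = rk M A + rk M (ground M)"
      using r[OF sub(1)] r[OF sub(2)] r[of "{}"] r[of "ground M - A"] *(3) by simp
    moreover have "(A \<union> U) \<union> (A \<union> V) = ground M" "(A \<union> U) \<inter> (A \<union> V) = A"
      using * A by blast+
    ultimately have "A \<union> U = A \<or> A \<union> V = A" using assms(2) unfolding sep_free_def by blast
    then show "U = {} \<or> V = {}" using sub by blast
  qed
qed

end

lemma connected_sep_free:
  assumes "connected_matroid M" shows "sep_free M {} (ground M)"
  unfolding sep_free_def
proof (intro allI impI)
  fix U V assume *: "U \<union> V = ground M" "U \<inter> V = {}" "rk M U + rk M V = rk M {} + rk M (ground M)"
  have m: "matroid M" using assms by (simp add: connected_matroid_def)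
  have "M = direct_sum (restriction M U) (restriction M V)"
    using direct_sum_restrictions[OF m *(1,2)] *(3) rk_empty[OF m] by simp
  moreover have "U \<subseteq> ground M" "V \<subseteq> ground M" using * by auto
  moreover have "ground (restriction M U) = U" "ground (restriction M V) = V"
    using * by (auto simp: restriction_def)
  ultimately show "U = {} \<or> V = {}"
    using assms * matroid_restriction[OF m] unfolding connected_matroid_def by metis
qed

section \<open>Sets on which a non-basis exceeds the rank\<close>

text \<open>For a separation \<open>U\<close>, \<open>V\<close> of \<open>M/A\<close> the excesses
  of \<open>U\<close> and \<open>V\<close> add up to those of \<open>A\<close> and of the ground
  set, and the latter is 0. So \<open>U\<close> or \<open>V\<close> has positive excess, and
  maximality makes it equal to \<open>A\<close>.\<close>

lemma sep_free_ground_if_maximal: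
  assumes m: "matroid M" and B: "B \<subseteq> ground M" "card B = matroid_rank M"
    and A: "A \<subseteq> ground M" "rk M A < card (B \<inter> A)"
    and max: "\<And>X. X \<subseteq> ground M \<Longrightarrow> rk M X < card (B \<inter> X) \<Longrightarrow> A \<subseteq> X \<Longrightarrow> X = A"
  shows "sep_free M A (ground M)"
  unfolding sep_free_def
proof (intro allI impI)
  fix U V assume UV: "U \<union> V = ground M" "U \<inter> V = A" "rk M U + rk M V = rk M A + rk M (ground M)"
  have fin: "finite B" using B finite_ground[OF m] finite_subset by blast
  have "card (B \<inter> U) + card (B \<inter> V) = card (B \<inter> U \<union> B \<inter> V) + card ((B \<inter> U) \<inter> (B \<inter> V))"
    using fin by (intro card_Un_Int) auto
  moreover have "B \<inter> U \<union> B \<inter> V = B" "(B \<inter> U) \<inter> (B \<inter> V) = B \<inter> A" using UV B by auto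
  ultimately have "rk M U + rk M V < card (B \<inter> U) + card (B \<inter> V)"
    using UV A B by (simp add: matroid_rank_def)
  then have "rk M U < card (B \<inter> U) \<or> rk M V < card (B \<inter> V)" by linarith
  then show "U = A \<or> V = A" using max[of U] max[of V] UV by blast
qed

text \<open>Here \<open>C\<close> is a direct summand of \<open>M|A\<close>. A separation
  \<open>U\<close>, \<open>V\<close> of \<open>M/C\<close> becomes one of \<open>M/A\<close> after
  adding \<open>A\<close> to both sides, so one side, say \<open>U\<close>, lies in
  \<open>A\<close>. Then \<open>U - C\<close> lies in the other summand \<open>D\<close>, its rank
  adds to that of \<open>C\<close>, and \<open>U - C\<close> together with \<open>V\<close>
  separates \<open>M\<close>. Since \<open>V\<close> contains the non-empty \<open>C\<close>,
  connectedness of \<open>M\<close> leaves only \<open>U = C\<close>.\<close>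

lemma sep_free_ground_summand:
  assumes m: "matroid M" and con: "sep_free M {} (ground M)" and A: "A \<subseteq> ground M" "sep_free M A (ground M)"
    and CD: "C \<union> D = A" "C \<inter> D = {}" "rk M C + rk M D = rk M A" and C: "C \<noteq> {}"
  shows "sep_free M C (ground M)"
proof -
  have small: "U = C" if UV: "U \<union> V = ground M" "U \<inter> V = C" "rk M U + rk M V = rk M C + rk M (ground M)"
    and "U \<subseteq> A" for U V
  proof -
    let ?W = "U - C"
    have "rk M U + rk M (C \<inter> D) = rk M (U \<inter> C) + rk M (U \<inter> D)"
      using CD \<open>U \<subseteq> A\<close> rk_empty[OF m] by (intro rk_separation[OF m]) auto
    moreover have "U \<inter> C = C" "U \<inter> D = ?W" using UV CD \<open>U \<subseteq> A\<close> by auto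
    ultimately have "rk M ?W + rk M V = rk M {} + rk M (ground M)"
      using UV CD rk_empty[OF m] by simp
    moreover have "?W \<union> V = ground M" "?W \<inter> V = {}" using UV by auto
    ultimately have "?W = {} \<or> V = {}" using con unfolding sep_free_def by blast
    then show "U = C" using UV C by auto
  qed
  show ?thesis
    unfolding sep_free_def
  proof (intro allI impI)
    fix U V assume UV: "U \<union> V = ground M" "U \<inter> V = C" "rk M U + rk M V = rk M C + rk M (ground M)"
    have sep: "rk M X + rk M C = rk M (X \<inter> U) + rk M (X \<inter> V)" if "C \<subseteq> X" "X \<subseteq> ground M" for X
      using rk_separation[OF m, of U V X] UV that by simp
    have CA: "C \<subseteq> A" using CD by auto
    have "(A \<union> U) \<inter> U = U" "(A \<union> U) \<inter> V = A \<inter> V" "(A \<union> V) \<inter> U = A \<inter> U" "(A \<union> V) \<inter> V = V"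
      using UV CA by auto
    moreover have "C \<subseteq> A \<union> U" "A \<union> U \<subseteq> ground M" "C \<subseteq> A \<union> V" "A \<union> V \<subseteq> ground M" using UV CA A by auto
    ultimately have "rk M (A \<union> U) + rk M (A \<union> V) = rk M A + rk M (ground M)"
      using sep[of "A \<union> U"] sep[of "A \<union> V"] sep[of A] UV(3) CA A by simp
    moreover have "(A \<union> U) \<union> (A \<union> V) = ground M" "(A \<union> U) \<inter> (A \<union> V) = A"
      using UV CA A by auto
    ultimately have "A \<union> U = A \<or> A \<union> V = A" using A(2) unfolding sep_free_def by blast
    then show "U = C \<or> V = C"
    proof
      assume "A \<union> U = A"
      then show ?thesis using small[OF UV] by auto
    next
      assume "A \<union> V = A"
      then have "V = C" using UV by (intro small[of V U]) (auto simp: Un_commute Int_commute add.commute)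
      then show ?thesis by simp
    qed
  qed
qed

text \<open>
  The excess \<open>card (B \<inter> A) - rk M A\<close> is positive for \<open>A = B\<close>.  It is supermodular and vanishes on the
  ground set, so a largest \<open>A\<close> of positive excess has connected contraction; a smallest such \<open>A\<close>
  among those with connected contraction moreover has connected restriction.
\<close>

lemma connected_nonbase_ex_split_flacet:
  assumes con: "connected_matroid M"
    and B: "B \<subseteq> ground M" "card B = matroid_rank M" "B \<notin> bases M"
  shows "\<exists>F. split_flacet M F \<and> rk M F < card (B \<inter> F)"
proof -
  let ?E = "ground M"
  have m: "matroid M" using con by (simp add: connected_matroid_def)
  have fin: "finite ?E" "finite B" using finite_ground[OF m] B finite_subset by auto
  have csep: "sep_free M {} ?E" using connected_sep_free[OF con] .
  define P where "P = {A. A \<subseteq> ?E \<and> rk M A < card (B \<inter> A)}"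
  have "B \<in> P"
  proof -
    have "rk M B \<le> card B" using rk_le_card[OF m fin(2)] .
    moreover have "rk M B \<noteq> card B" using B indep_iff_rk[OF m fin(2)] base_iff[OF m] by blast
    ultimately show ?thesis using B by (simp add: P_def)
  qed
  have finP: "finite P" by (rule finite_subset[of _ "Pow ?E"]) (use fin in \<open>auto simp: P_def\<close>)
  obtain A0 where A0: "A0 \<in> P" "\<And>X. X \<in> P \<Longrightarrow> A0 \<subseteq> X \<Longrightarrow> A0 = X"
    using finite_has_maximal[OF finP] \<open>B \<in> P\<close> by blast
  then have "sep_free M A0 ?E"
    by (intro sep_free_ground_if_maximal[OF m B(1,2)]) (auto simp: P_def)
  then have "A0 \<in> {A \<in> P. sep_free M A ?E}" using A0 by simp
  then obtain F where F0: "F \<in> {A \<in> P. sep_free M A ?E}"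
    and Fmin: "\<And>X. X \<in> {A \<in> P. sep_free M A ?E} \<Longrightarrow> X \<subseteq> F \<Longrightarrow> F = X"
    using finite_has_minimal[of "{A \<in> P. sep_free M A ?E}"] finP by auto
  have F: "F \<subseteq> ?E" "rk M F < card (B \<inter> F)" and Fsep: "sep_free M F ?E" using F0 by (auto simp: P_def)
  have rkE: "rk M ?E = card B" using B by (simp add: matroid_rank_def)
  have "sep_free M {} F"
    unfolding sep_free_def
  proof (intro allI impI)
    fix C D assume CD: "C \<union> D = F" "C \<inter> D = {}" "rk M C + rk M D = rk M {} + rk M F"
    have CD': "rk M C + rk M D = rk M F" "D \<union> C = F" "D \<inter> C = {}" "rk M D + rk M C = rk M F"
      using CD rk_empty[OF m] by auto
    have "B \<inter> F = (B \<inter> C) \<union> (B \<inter> D)" using CD by auto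
    then have "card (B \<inter> F) = card (B \<inter> C) + card (B \<inter> D)"
      using fin CD by (simp, intro card_Un_disjoint) auto
    \<comment> \<open>The excess is additive over the summands, so one of them has positive excess.
      It inherits the connected contraction, and minimality makes it all of
      \<open>F\<close>.\<close>
    then have "rk M C < card (B \<inter> C) \<or> rk M D < card (B \<inter> D)" using F CD' by linarith
    then show "C = {} \<or> D = {}"
    proof
      assume c: "rk M C < card (B \<inter> C)"
      then have "C \<noteq> {}" by auto
      then have "sep_free M C ?E"
        using sep_free_ground_summand[OF m csep F(1) Fsep CD(1,2) CD'(1)] by simp
      then have "C \<in> {A \<in> P. sep_free M A ?E}" using c CD F by (auto simp: P_def)
      then show ?thesis using Fmin[of C] CD by auto
    next
      assume c: "rk M D < card (B \<inter> D)"
      then have "D \<noteq> {}" by auto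
      then have "sep_free M D ?E"
        using sep_free_ground_summand[OF m csep F(1) Fsep CD'(2,3,4)] by simp
      then have "D \<in> {A \<in> P. sep_free M A ?E}" using c CD F by (auto simp: P_def)
      then show ?thesis using Fmin[of D] CD by auto
    qed
  qed
  then have conres: "connected_matroid (restriction M F)" using connected_restrictionI[OF m F(1)] by simp
  have concon: "connected_matroid (contraction M F)" using connected_contractionI[OF m F(1) Fsep] .
  have ne: "F \<noteq> {}" using F by auto
  have subB: "card (B \<inter> F) \<le> card B" using fin by (intro card_mono) auto
  have "flat M F"
    unfolding flat_def
  proof (intro conjI ballI F(1))
    fix e assume e: "e \<in> ?E - F"
    \<comment> \<open>Otherwise \<open>e\<close> is a loop of the connected \<open>M/F\<close>,
      which leaves no other element outside \<open>F\<close>. Then \<open>F\<close> has full rank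
      and cannot have positive excess.\<close>
    show "rk M F < rk M (insert e F)"
    proof (rule ccontr)
      assume "\<not> ?thesis"
      then have eq: "rk M (insert e F) = rk M F"
        using rk_mono[OF m, of F "insert e F"] by (simp add: subset_insertI)
      have un: "insert e F \<union> (?E - {e}) = ?E" and int: "insert e F \<inter> (?E - {e}) = F" using e F by auto
      have "rk M ?E \<le> rk M (?E - {e})"
        using rk_submodular[OF m, of "insert e F" "?E - {e}"] eq unfolding un int by simp
      then have "rk M (?E - {e}) = rk M ?E" using rk_mono[OF m, of "?E - {e}" ?E] by auto
      then have "insert e F = F \<or> ?E - {e} = F"
        using Fsep un int eq unfolding sep_free_def by (metis add.commute)
      then have "?E - {e} = F" using e by auto
      then show False using \<open>rk M (?E - {e}) = rk M ?E\<close> rkE F subB by simp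
    qed
  qed
  \<comment> \<open>If \<open>F\<close> had rank 0, an element of \<open>B \<inter> F\<close> would
    be a loop. In a connected matroid it would be the only element, so the rank would be 0, while
    \<open>B\<close> is non-empty.\<close>
  moreover have "0 < rk M F"
  proof (rule ccontr)
    assume "\<not> ?thesis"
    then have rF: "rk M F = 0" by simp
    then obtain e where e: "e \<in> B" "e \<in> F" using F by (metis IntE card.empty equals0I less_irrefl)
    have re: "rk M {e} = 0" using rk_mono[OF m, of "{e}" F] e rF by simp
    have un: "{e} \<union> (?E - {e}) = ?E" and int: "{e} \<inter> (?E - {e}) = {}" using e F by auto
    have "rk M ?E \<le> rk M (?E - {e})"
      using rk_submodular[OF m, of "{e}" "?E - {e}"] re unfolding un int by simp
    then have "rk M (?E - {e}) = rk M ?E" using rk_mono[OF m, of "?E - {e}" ?E] by auto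
    then have "{e} = {} \<or> ?E - {e} = {}"
      using csep un int re rk_empty[OF m] unfolding sep_free_def by metis
    then have "?E = {e}" using e B(1) by blast
    then show False using rkE re e fin by auto
  qed
  moreover have "rk M F < card F"
    using F(2) card_mono[of F "B \<inter> F"] finite_subset[OF F(1) fin(1)] by simp
  \<comment> \<open>The ground set has excess 0, so \<open>F\<close> is a proper subset. A coloop
    outside \<open>F\<close> would split off as a direct summand, although \<open>F\<close> is
    non-empty and \<open>M\<close> is connected.\<close>
  moreover have "\<exists>e\<in>?E - F. \<not> coloop M e"
  proof (rule ccontr)
    assume no: "\<not> ?thesis"
    have "F \<noteq> ?E" using F(2) rkE subB by auto
    then obtain e where e: "e \<in> ?E - F" using F by auto
    then have "coloop M e" using no by blast
    then have co: "\<And>B. B \<in> bases M \<Longrightarrow> e \<in> B" by (simp add: coloop_def)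
    obtain C where C: "C \<in> bases M" "card ((?E - {e}) \<inter> C) = rk M (?E - {e})"
      using ex_base_card_rk[OF m] .
    have "(?E - {e}) \<inter> C = C - {e}" using base_subset[OF m C(1)] by auto
    then have "rk M (?E - {e}) + 1 = rk M ?E"
      using C card_base[OF m C(1)] co[OF C(1)] finite_base[OF m C(1)]
      by (metis Suc_eq_plus1 card_Suc_Diff1 matroid_rank_def)
    moreover have "rk M {e} \<le> 1" using rk_le_card[OF m, of "{e}"] by simp
    moreover have un: "{e} \<union> (?E - {e}) = ?E" and int: "{e} \<inter> (?E - {e}) = {}" using e F by auto
    moreover have "rk M ?E \<le> rk M {e} + rk M (?E - {e})"
      using rk_submodular[OF m, of "{e}" "?E - {e}"] unfolding un int by simp
    ultimately have "rk M {e} + rk M (?E - {e}) = rk M {} + rk M ?E"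
      using rk_empty[OF m] by simp
    then have "{e} = {} \<or> ?E - {e} = {}" using csep un int unfolding sep_free_def by metis
    then show False using e F ne by auto
  qed
  ultimately have "split_flacet M F"
    using conres concon by (simp add: split_flacet_def flacet_def)
  then show ?thesis using F by blast
qed

section \<open>Stressed subsets\<close>

context
  fixes M :: set_system and F :: "nat set"
  assumes matroid: "matroid M" and stressed: "stressed M F"
begin

lemma stressed_subset: "F \<subseteq> ground M"
  using stressed by (simp add: stressed_def)

lemma finite_stressed: "finite F"
  using stressed_subset finite_ground[OF matroid] finite_subset by blast

lemma stressed_restriction: "restriction M F = uniform_on F (rk M F)" and stressed_rk_le: "rk M F \<le> card F"
proof -
  have g: "ground (restriction M F) = F" using stressed_subset by (auto simp: restriction_def)
  obtain j where j: "j \<le> card F" "restriction M F = uniform_on F j"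
    using stressed g by (auto simp: stressed_def uniform_def)
  obtain B where B: "B \<in> bases M" "card (F \<inter> B) = rk M F" using ex_base_card_rk[OF matroid] .
  then have "F \<inter> B \<in> bases (restriction M F)" by (auto simp: restriction_def)
  then have "j = rk M F" using j B by (simp add: uniform_on_def)
  then show "restriction M F = uniform_on F (rk M F)" "rk M F \<le> card F" using j by auto
qed

lemma stressed_contraction: "contraction M F = uniform_on (ground M - F) (matroid_rank M - rk M F)"
  and stressed_corank_le: "matroid_rank M - rk M F \<le> card (ground M - F)"
  and stressed_rk_le_rank: "rk M F \<le> matroid_rank M"
proof -
  have g: "ground (contraction M F) = ground M - F" by (auto simp: contraction_def)
  obtain j where j: "j \<le> card (ground M - F)" "contraction M F = uniform_on (ground M - F) j"
    using stressed g by (auto simp: stressed_def uniform_def)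
  obtain B where B: "B \<in> bases M" "card (F \<inter> B) = rk M F" using ex_base_card_rk[OF matroid] .
  then have "B - F \<in> bases (contraction M F)" by (auto simp: contraction_def)
  then have "j = card (B - F)" using j by (simp add: uniform_on_def)
  moreover have "card (B - F) + rk M F = card B"
    using B(2) card_Diff_subset_Int[of B F] finite_base[OF matroid B(1)] card_mono[of B "B \<inter> F"]
    by (simp add: Int_commute)
  ultimately have "j = matroid_rank M - rk M F" "rk M F \<le> matroid_rank M"
    using card_base[OF matroid B(1)] by linarith+
  then show "contraction M F = uniform_on (ground M - F) (matroid_rank M - rk M F)"
    "matroid_rank M - rk M F \<le> card (ground M - F)" "rk M F \<le> matroid_rank M" using j by auto
qed

lemma stressed_rk_subset:
  assumes "X \<subseteq> F" "card X \<le> rk M F" shows "rk M X = card X"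
proof -
  obtain Y where Y: "X \<subseteq> Y" "Y \<subseteq> F" "card Y = rk M F"
    using assms stressed_rk_le finite_stressed by (metis exists_subset_between)
  then have "Y \<in> bases (restriction M F)"
    by (simp add: stressed_restriction uniform_on_def)
  then have "indep M X" using Y indep_subset[OF matroid]
    by (auto simp: restriction_base_iff[OF matroid stressed_subset])
  then show ?thesis using indep_iff_rk[OF matroid] finite_indep[OF matroid] by blast
qed

text \<open>Uniformity of \<open>M/F\<close> extends \<open>X\<close> to a basis of
  \<open>M/F\<close>, hence, with \<open>rk M F\<close> elements of \<open>F\<close>, to a basis of
  \<open>M\<close>; this is the lower bound. Submodularity is the upper one.\<close>

lemma stressed_rk_superset:
  assumes "X \<subseteq> ground M - F" "card X \<le> matroid_rank M - rk M F" shows "rk M (F \<union> X) = rk M F + card X"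
proof -
  have finX: "finite X" using assms finite_ground[OF matroid] finite_subset by blast
  obtain Y where Y: "X \<subseteq> Y" "Y \<subseteq> ground M - F" "card Y = matroid_rank M - rk M F"
    using assms stressed_corank_le finite_ground[OF matroid] by (metis exists_subset_between finite_Diff)
  then have "Y \<in> bases (contraction M F)"
    by (simp add: stressed_contraction uniform_on_def)
  then obtain B where B: "B \<in> bases M" "Y = B - F" "card (F \<inter> B) = rk M F"
    by (auto simp: contraction_def)
  have "card ((F \<inter> B) \<union> X) = rk M F + card X"
    using B finX finite_stressed assms(1) by (subst card_Un_disjoint) auto
  moreover have "card ((F \<inter> B) \<union> X) \<le> rk M (F \<union> X)"
    using B Y by (intro indep_card_le_rk[OF matroid]) (auto simp: indep_def)
  moreover have "rk M (F \<union> X) + rk M (F \<inter> X) \<le> rk M F + rk M X" by (rule rk_submodular[OF matroid])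
  ultimately show ?thesis using rk_le_card[OF matroid finX] by linarith
qed

context
  assumes cover: "cover M F \<noteq> {}"
begin

lemma cover_rk_less: "rk M F < card F" "rk M F < matroid_rank M"
proof -
  obtain S where S: "S \<subseteq> ground M" "card S = matroid_rank M" "rk M F + 1 \<le> card (S \<inter> F)"
    using cover by (auto simp: cover_def)
  have "finite S" using S finite_ground[OF matroid] finite_subset by blast
  then have "card (S \<inter> F) \<le> card S" "card (S \<inter> F) \<le> card F"
    using finite_stressed by (auto intro: card_mono)
  then show "rk M F < card F" "rk M F < matroid_rank M" using S by linarith+
qed

text \<open>A non-empty cover makes the rank of \<open>M/F\<close> positive, and a uniform matroid
  of positive rank has no loops. So \<open>F\<close> is a flat.\<close>

lemma stressed_closed:
  assumes "X \<subseteq> ground M" "rk M (F \<union> X) = rk M F" shows "X \<subseteq> F"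
proof (rule ccontr)
  assume "\<not> X \<subseteq> F"
  then obtain e where e: "e \<in> X" "e \<notin> F" by auto
  then have "rk M (F \<union> {e}) = rk M F + card {e}"
    using assms cover_rk_less(2) by (intro stressed_rk_superset) auto
  moreover have "rk M (F \<union> {e}) \<le> rk M (F \<union> X)" using e by (intro rk_mono[OF matroid]) auto
  ultimately show False using assms by simp
qed

end
end

lemma stressed_pair:
  assumes m: "matroid M" and F: "stressed M F" "cover M F \<noteq> {}" and G: "stressed M G" "cover M G \<noteq> {}"
    and ne: "F \<noteq> G"
  shows "matroid_rank M + card (F \<inter> G) \<le> rk M F + rk M G"
proof -
  have sub: "F \<subseteq> ground M" "G \<subseteq> ground M" using F G by (auto simp: stressed_def)
  have finF: "finite F" "finite G" using finite_stressed[OF m] F G by auto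
  have sm: "rk M (F \<union> G) + rk M (F \<inter> G) \<le> rk M F + rk M G" by (rule rk_submodular[OF m])
  \<comment> \<open>Otherwise \<open>F \<inter> G\<close> contains a basis of \<open>F\<close>, so
    \<open>G\<close> spans \<open>F\<close>, and closedness gives \<open>F \<subseteq> G\<close>. As
    \<open>F\<close> is dependent, it has more than \<open>rk M G\<close> elements, so uniformity of
    \<open>M|G\<close> makes it span \<open>G\<close>, and closedness of \<open>F\<close> gives
    \<open>F = G\<close>.\<close>
  have lt: "card (F \<inter> G) < rk M F"
  proof (rule ccontr)
    assume "\<not> ?thesis"
    then obtain X where X: "X \<subseteq> F \<inter> G" "card X = rk M F" by (metis not_less obtain_subset_with_card_n)
    then have "rk M F \<le> rk M (F \<inter> G)"
      using stressed_rk_subset[OF m F(1), of X] rk_mono[OF m, of X "F \<inter> G"] by simp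
    then have "rk M (G \<union> F) = rk M G"
      using sm rk_mono[OF m, of G "G \<union> F"] by (simp add: Un_commute)
    then have FG: "F \<subseteq> G" using stressed_closed[OF m G sub(1)] by simp
    have "rk M G < card F"
      using stressed_rk_subset[OF m G(1) FG] cover_rk_less(1)[OF m F] by linarith
    then obtain Y where Y: "Y \<subseteq> F" "card Y = rk M G" by (metis less_imp_le obtain_subset_with_card_n)
    then have "rk M G \<le> rk M F"
      using stressed_rk_subset[OF m G(1), of Y] FG rk_mono[OF m, of Y F] by simp
    moreover have "F \<union> G = G" using FG by auto
    ultimately have "rk M (F \<union> G) = rk M F" using rk_mono[OF m FG] by simp
    then show False using stressed_closed[OF m F sub(2)] FG ne by simp
  qed
  then have rkFG: "rk M (F \<inter> G) = card (F \<inter> G)" using stressed_rk_subset[OF m F(1)] by simp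
  have cG: "card G = card (F \<inter> G) + card (G - F)"
    using finF card_Diff_subset_Int[of G F] card_mono[of G "G \<inter> F"] by (simp add: Int_commute)
  \<comment> \<open>Otherwise the rank of \<open>F \<union> G\<close> exceeds that of
    \<open>F\<close> by \<open>card (G - F)\<close>, and submodularity makes \<open>G\<close>
    independent, against \<open>cover_rk_less\<close>.\<close>
  have "matroid_rank M - rk M F < card (G - F)"
  proof (rule ccontr)
    assume "\<not> ?thesis"
    then have "rk M (F \<union> (G - F)) = rk M F + card (G - F)"
      using sub by (intro stressed_rk_superset[OF m F(1)]) auto
    then have "card G \<le> rk M G" using sm rkFG cG by simp
    then show False using cover_rk_less(1)[OF m G] by simp
  qed
  then obtain X where X: "X \<subseteq> G - F" "card X = matroid_rank M - rk M F"
    by (metis less_imp_le obtain_subset_with_card_n)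
  then have "rk M (F \<union> X) = rk M F + card X"
    using sub by (intro stressed_rk_superset[OF m F(1)]) auto
  then have "rk M (F \<union> X) = matroid_rank M" using X stressed_rk_le_rank[OF m F(1)] by simp
  moreover have "rk M (F \<union> X) \<le> rk M (F \<union> G)" using X by (intro rk_mono[OF m]) auto
  ultimately show ?thesis using sm rkFG by linarith
qed

section \<open>Elementary split matroids as constrained uniform matroids\<close>

lemma rk_eqI:
  assumes "bases M \<noteq> {}" "\<And>B. B \<in> bases M \<Longrightarrow> card (A \<inter> B) = c"
  shows "rk M A = c"
proof -
  have "(\<lambda>B. card (A \<inter> B)) ` bases M = {c}" using assms by fastforce
  then show ?thesis by (simp add: rk_def)
qed

lemma card_split:
  assumes "finite E1" "finite E2" "E1 \<inter> E2 = {}" "X \<subseteq> E1 \<union> E2"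
  shows "card X = card (X \<inter> E1) + card (X \<inter> E2)"
proof -
  have "X = (X \<inter> E1) \<union> (X \<inter> E2)" using assms by auto
  then have "card X = card ((X \<inter> E1) \<union> (X \<inter> E2))" by simp
  also have "\<dots> = card (X \<inter> E1) + card (X \<inter> E2)" using assms by (intro card_Un_disjoint) auto
  finally show ?thesis .
qed

section \<open>Direct sums of two uniform matroids and their relaxations\<close>

lemma direct_sum_commute: "direct_sum M N = direct_sum N M"
  by (auto simp: direct_sum_def)

context
  fixes E1 E2 :: "nat set" and a b :: nat
  assumes fin: "finite E1" "finite E2" and disj: "E1 \<inter> E2 = {}"
begin

lemma bases_direct_sum_uniform:
  "bases (direct_sum (uniform_on E1 a) (uniform_on E2 b)) =
     {X. X \<subseteq> E1 \<union> E2 \<and> card (E1 \<inter> X) = a \<and> card (E2 \<inter> X) = b}"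
proof (intro equalityI subsetI)
  fix X assume "X \<in> bases (direct_sum (uniform_on E1 a) (uniform_on E2 b))"
  then obtain B C where BC: "X = B \<union> C" "B \<subseteq> E1" "C \<subseteq> E2" "card B = a" "card C = b"
    by (auto simp: direct_sum_def uniform_on_def)
  then have "E1 \<inter> X = B" "E2 \<inter> X = C" using disj by auto
  then show "X \<in> {X. X \<subseteq> E1 \<union> E2 \<and> card (E1 \<inter> X) = a \<and> card (E2 \<inter> X) = b}" using BC by auto
next
  fix X assume X: "X \<in> {X. X \<subseteq> E1 \<union> E2 \<and> card (E1 \<inter> X) = a \<and> card (E2 \<inter> X) = b}"
  then have "X = (E1 \<inter> X) \<union> (E2 \<inter> X)" by auto
  moreover have "E1 \<inter> X \<in> bases (uniform_on E1 a)" "E2 \<inter> X \<in> bases (uniform_on E2 b)"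
    using X by (auto simp: uniform_on_def)
  ultimately have "X \<in> {B \<union> C |B C. B \<in> bases (uniform_on E1 a) \<and> C \<in> bases (uniform_on E2 b)}"
    by (intro CollectI exI[of _ "E1 \<inter> X"] exI[of _ "E2 \<inter> X"] conjI)
  then show "X \<in> bases (direct_sum (uniform_on E1 a) (uniform_on E2 b))"
    by (simp add: direct_sum_def)
qed

text \<open>The two upper bounds add up to the prescribed size, so both must be attained.\<close>

lemma direct_sum_uniform_constrained:
  "direct_sum (uniform_on E1 a) (uniform_on E2 b) = constrained (E1 \<union> E2) (a + b) {(E1, a), (E2, b)}"
proof -
  have "bases (direct_sum (uniform_on E1 a) (uniform_on E2 b)) =
      bases (constrained (E1 \<union> E2) (a + b) {(E1, a), (E2, b)})"
    unfolding bases_direct_sum_uniform using card_split[OF fin disj]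
    by (fastforce simp: constrained_def Int_commute)
  then show ?thesis by (simp add: constrained_def direct_sum_def uniform_on_def)
qed

context
  assumes le: "a \<le> card E1" "b \<le> card E2"
begin

lemma bases_direct_sum_uniform_nonempty: "bases (direct_sum (uniform_on E1 a) (uniform_on E2 b)) \<noteq> {}"
proof -
  obtain B C where "B \<subseteq> E1" "C \<subseteq> E2" "card B = a" "card C = b"
    using le obtain_subset_with_card_n by metis
  then show ?thesis by (auto simp: direct_sum_def uniform_on_def)
qed

lemma rk_direct_sum_uniform:
  "rk (direct_sum (uniform_on E1 a) (uniform_on E2 b)) E1 = a"
  "rk (direct_sum (uniform_on E1 a) (uniform_on E2 b)) E2 = b"
  "matroid_rank (direct_sum (uniform_on E1 a) (uniform_on E2 b)) = a + b"
proof -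
  have g: "ground (direct_sum (uniform_on E1 a) (uniform_on E2 b)) = E1 \<union> E2"
    by (simp add: direct_sum_def uniform_on_def)
  show "rk (direct_sum (uniform_on E1 a) (uniform_on E2 b)) E1 = a"
    "rk (direct_sum (uniform_on E1 a) (uniform_on E2 b)) E2 = b"
    by (rule rk_eqI[OF bases_direct_sum_uniform_nonempty]; simp add: bases_direct_sum_uniform)+
  show "matroid_rank (direct_sum (uniform_on E1 a) (uniform_on E2 b)) = a + b"
    unfolding matroid_rank_def g
  proof (rule rk_eqI[OF bases_direct_sum_uniform_nonempty])
    fix B assume "B \<in> bases (direct_sum (uniform_on E1 a) (uniform_on E2 b))"
    then have "B \<subseteq> E1 \<union> E2" "card (E1 \<inter> B) = a" "card (E2 \<inter> B) = b" by (auto simp: bases_direct_sum_uniform)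
    moreover from this have "(E1 \<union> E2) \<inter> B = B" by auto
    ultimately show "card ((E1 \<union> E2) \<inter> B) = a + b"
      using card_split[OF fin disj, of B] by (simp add: Int_commute[of B])
  qed
qed

lemma stressed_direct_sum_uniform: "stressed (direct_sum (uniform_on E1 a) (uniform_on E2 b)) E1"
proof -
  let ?M = "direct_sum (uniform_on E1 a) (uniform_on E2 b)"
  have g: "ground ?M = E1 \<union> E2" by (simp add: direct_sum_def uniform_on_def)
  have inM: "C \<union> D \<in> bases ?M" if "C \<subseteq> E1" "card C = a" "D \<subseteq> E2" "card D = b" for C D
    using that by (auto simp: direct_sum_def uniform_on_def)
  obtain C D where CD: "C \<subseteq> E1" "D \<subseteq> E2" "card C = a" "card D = b"
    using le obtain_subset_with_card_n by metis
  have "restriction ?M E1 = uniform_on E1 a"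
  proof -
    have "{E1 \<inter> B |B. B \<in> bases ?M \<and> card (E1 \<inter> B) = a} = {B. B \<subseteq> E1 \<and> card B = a}"
    proof (intro equalityI subsetI)
      fix X assume "X \<in> {B. B \<subseteq> E1 \<and> card B = a}"
      then have "X \<union> D \<in> bases ?M" and int: "E1 \<inter> (X \<union> D) = X" and "card X = a"
        using inM CD disj by auto
      then show "X \<in> {E1 \<inter> B |B. B \<in> bases ?M \<and> card (E1 \<inter> B) = a}"
        by (intro CollectI exI[of _ "X \<union> D"] conjI int[symmetric]) (simp_all only: int)
    qed auto
    moreover have "(E1 \<union> E2) \<inter> E1 = E1" by auto
    ultimately show ?thesis unfolding restriction_def rk_direct_sum_uniform g by (simp add: uniform_on_def[of E1 a])
  qed
  moreover have "contraction ?M E1 = uniform_on E2 b"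
  proof -
    have "{B - E1 |B. B \<in> bases ?M \<and> card (E1 \<inter> B) = a} = {B. B \<subseteq> E2 \<and> card B = b}"
    proof (intro equalityI subsetI)
      fix X assume "X \<in> {B - E1 |B. B \<in> bases ?M \<and> card (E1 \<inter> B) = a}"
      then obtain B where B: "X = B - E1" "B \<subseteq> E1 \<union> E2" "card (E2 \<inter> B) = b"
        by (auto simp: bases_direct_sum_uniform)
      then have "X = E2 \<inter> B" using disj by auto
      then show "X \<in> {B. B \<subseteq> E2 \<and> card B = b}" using B by auto
    next
      fix X assume "X \<in> {B. B \<subseteq> E2 \<and> card B = b}"
      then have "C \<union> X \<in> bases ?M" and diff: "(C \<union> X) - E1 = X" and int: "E1 \<inter> (C \<union> X) = C"
        using inM CD disj by auto
      then show "X \<in> {B - E1 |B. B \<in> bases ?M \<and> card (E1 \<inter> B) = a}"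
        using CD by (intro CollectI exI[of _ "C \<union> X"] conjI diff[symmetric]) (simp_all only: int)
    qed
    moreover have "(E1 \<union> E2) - E1 = E2" using disj by auto
    ultimately show ?thesis unfolding contraction_def rk_direct_sum_uniform g by (simp add: uniform_on_def[of E2 b])
  qed
  ultimately show ?thesis
    using le g by (auto simp: stressed_def uniform_def uniform_on_def)
qed

text \<open>Among sets of size \<open>a + b\<close>, the bases meet \<open>E1\<close> in exactly
  \<open>a\<close> elements, and the cover of \<open>E2\<close> consists of those that meet
  \<open>E1\<close> in fewer.\<close>

lemma relaxation_direct_sum_uniform:
  "relaxation (direct_sum (uniform_on E1 a) (uniform_on E2 b)) E2 = constrained (E1 \<union> E2) (a + b) {(E1, a)}"
proof -
  have g: "ground (direct_sum (uniform_on E1 a) (uniform_on E2 b)) = E1 \<union> E2"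
    by (simp add: direct_sum_def uniform_on_def)
  have "X \<in> bases (direct_sum (uniform_on E1 a) (uniform_on E2 b)) \<union>
        cover (direct_sum (uniform_on E1 a) (uniform_on E2 b)) E2 \<longleftrightarrow>
      X \<subseteq> E1 \<union> E2 \<and> card X = a + b \<and> card (X \<inter> E1) \<le> a" for X
    using card_split[OF fin disj, of X]
    by (auto simp: bases_direct_sum_uniform cover_def g rk_direct_sum_uniform Int_commute)
  then show ?thesis unfolding relaxation_def g by (auto simp: constrained_def)
qed

end
end

lemma matroid_direct_sum_uniform:
  assumes "finite E1" "finite E2" "E1 \<inter> E2 = {}" "a \<le> card E1" "b \<le> card E2" "E1 \<union> E2 \<subseteq> {0<..}"
  shows "matroid (direct_sum (uniform_on E1 a) (uniform_on E2 b))"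
proof -
  have "spread (E1 \<union> E2) (a + b) {(E1, a), (E2, b)}"
    using assms(3) by (auto simp: spread_def Int_commute)
  then show ?thesis
    unfolding direct_sum_uniform_constrained[OF assms(1-3)]
    using assms bases_direct_sum_uniform_nonempty[OF assms(1-5)]
    by (intro matroid_constrained) (auto simp: direct_sum_uniform_constrained[OF assms(1-3)])
qed

section \<open>Non-bases of elementary split matroids\<close>

lemma elementary_split_cases:
  assumes "elementary_split M"
  obtains "connected_split_matroid M"
  | E1 E2 a b where "finite E1" "finite E2" "E1 \<inter> E2 = {}" "a \<le> card E1" "b \<le> card E2" "E1 \<union> E2 \<subseteq> {0<..}"
      "M = direct_sum (uniform_on E1 a) (uniform_on E2 b)"
proof (cases "connected_split_matroid M")
  case False
  then obtain N1 N2 where N: "matroid N1" "matroid N2" "uniform N1" "uniform N2"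
      "ground N1 \<inter> ground N2 = {}" "M = direct_sum N1 N2"
    using assms unfolding elementary_split_def by blast
  obtain a b where ab: "a \<le> card (ground N1)" "N1 = uniform_on (ground N1) a"
      "b \<le> card (ground N2)" "N2 = uniform_on (ground N2) b"
    using N unfolding uniform_def by blast
  moreover have "M = direct_sum (uniform_on (ground N1) a) (uniform_on (ground N2) b)"
    using N(6) ab by simp
  ultimately show thesis
    using that(2)[of "ground N1" "ground N2" a b] N(1,2,5) by (simp add: matroid_def)
qed (rule that(1))

lemma elementary_split_matroid: "elementary_split M \<Longrightarrow> matroid M"
  by (erule elementary_split_cases)
    (simp_all add: connected_split_matroid_def connected_matroid_def matroid_direct_sum_uniform)

text \<open>In the connected case the set is a split flacet, stressed by definition. In a direct sum
  the intersections of \<open>B\<close> with \<open>E1\<close> and \<open>E2\<close> have total size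
  \<open>a + b\<close>, so a non-basis exceeds the bound on one of these stressed sets.\<close>

lemma elementary_split_nonbase:
  assumes "elementary_split M" and B: "B \<subseteq> ground M" "card B = matroid_rank M" "B \<notin> bases M"
  shows "\<exists>F. stressed M F \<and> rk M F < card (B \<inter> F)"
  using assms(1)
proof (cases rule: elementary_split_cases)
  case 1
  then show ?thesis
    using connected_nonbase_ex_split_flacet[OF _ B] unfolding connected_split_matroid_def by blast
next
  case (2 E1 E2 a b)
  note M = 2(7)
  have disj': "E2 \<inter> E1 = {}" using 2 by auto
  have "stressed M E1" "rk M E1 = a"
    unfolding M by (rule stressed_direct_sum_uniform[OF 2(1-5)], rule rk_direct_sum_uniform(1)[OF 2(1-5)])
  moreover have "stressed M E2" "rk M E2 = b"
    unfolding M using stressed_direct_sum_uniform[OF 2(2,1) disj' 2(5,4)] rk_direct_sum_uniform[OF 2(1-5)]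
    by (simp_all add: direct_sum_commute)
  moreover have sub: "B \<subseteq> E1 \<union> E2" using B(1) by (simp add: M direct_sum_def uniform_on_def)
  then have "card (B \<inter> E1) + card (B \<inter> E2) = a + b"
    using B(2) card_split[OF 2(1-3)] rk_direct_sum_uniform(3)[OF 2(1-5)] by (simp add: M)
  then have "a < card (B \<inter> E1) \<or> b < card (B \<inter> E2)"
    using B(3) sub bases_direct_sum_uniform[OF 2(1-3)] by (auto simp: M Int_commute)
  ultimately show ?thesis by blast
qed

definition stressed_sets :: "set_system \<Rightarrow> nat set set" where
  "stressed_sets M = {F. stressed M F \<and> cover M F \<noteq> {}}"

lemma finite_stressed_sets: "matroid M \<Longrightarrow> finite (stressed_sets M)"
  by (rule finite_subset[of _ "Pow (ground M)"])
    (auto simp: stressed_sets_def stressed_def finite_ground)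

text \<open>A non-basis that exceeds the rank of a stressed set lies in its cover. The sets of
  non-empty cover therefore already exclude every non-basis.\<close>

lemma elementary_split_constrained:
  assumes "elementary_split M"
  shows "M = constrained (ground M) (matroid_rank M) ((\<lambda>F. (F, rk M F)) ` stressed_sets M)"
proof -
  have m: "matroid M" using elementary_split_matroid[OF assms] .
  have "B \<in> bases M \<longleftrightarrow> B \<subseteq> ground M \<and> card B = matroid_rank M \<and> (\<forall>F\<in>stressed_sets M. card (B \<inter> F) \<le> rk M F)"
    (is "_ \<longleftrightarrow> ?R") for B
  proof
    assume "B \<in> bases M"
    then show ?R using base_subset[OF m] card_base[OF m] card_le_rk[OF m] by (metis Int_commute)
  next
    assume R: ?R
    show "B \<in> bases M"
    proof (rule ccontr)
      assume "B \<notin> bases M"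
      then obtain F where F: "stressed M F" "rk M F < card (B \<inter> F)"
        using elementary_split_nonbase[OF assms] R by blast
      then have "B \<in> cover M F" using R by (simp add: cover_def)
      then show False using R F by (force simp: stressed_sets_def)
    qed
  qed
  then have "bases M = bases (constrained (ground M) (matroid_rank M) ((\<lambda>F. (F, rk M F)) ` stressed_sets M))"
    by (auto simp: constrained_def)
  then show ?thesis by (simp add: constrained_def)
qed

lemma spread_stressed_sets:
  assumes m: "matroid M"
  shows "spread (ground M) (matroid_rank M) ((\<lambda>F. (F, rk M F)) ` stressed_sets M)"
proof -
  have "F \<subseteq> ground M" if "F \<in> stressed_sets M" for F
    using that by (auto simp: stressed_sets_def stressed_def)
  moreover have "matroid_rank M + card (F \<inter> G) \<le> rk M F + rk M G"
    if "F \<in> stressed_sets M" "G \<in> stressed_sets M" "F \<noteq> G" for F G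
    using that stressed_pair[OF m] by (simp add: stressed_sets_def)
  ultimately show ?thesis
    unfolding spread_def using finite_stressed_sets[OF m] by auto
qed

text \<open>For \<open>k\<close>-subsets the bound \<open>k - r\<close> on \<open>E - F\<close> says
  that \<open>F\<close> is met in at least \<open>r\<close> elements. Stating it on the complement
  turns this lower bound into an upper bound, as \<open>constrained\<close> expects.\<close>

abbreviation two_block :: "nat set \<Rightarrow> nat \<Rightarrow> nat set \<Rightarrow> nat \<Rightarrow> set_system" where
  "two_block E k F r \<equiv> constrained E k {(E - F, k - r), (F, r)}"

abbreviation relaxed_block :: "nat set \<Rightarrow> nat \<Rightarrow> nat set \<Rightarrow> nat \<Rightarrow> set_system" where
  "relaxed_block E k F r \<equiv> constrained E k {(E - F, k - r)}"

text \<open>The two blocks are disjoint and their bounds add up to \<open>k\<close>, so the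
  inequality of \<open>spread\<close> holds with equality.\<close>

lemma spread_two_block:
  assumes "F \<subseteq> E" "r \<le> k"
  shows "spread E k {(E - F, k - r), (F, r)}" "spread E k {(E - F, k - r)}"
proof -
  have "(E - F) \<inter> F = {}" "F \<inter> (E - F) = {}" by auto
  then show "spread E k {(E - F, k - r), (F, r)}" "spread E k {(E - F, k - r)}"
    using assms by (auto simp: spread_def)
qed

lemma matroid_two_block:
  assumes "finite E" "E \<subseteq> {0<..}" "F \<subseteq> E" "r \<le> card F" "r \<le> k" "k - r \<le> card (E - F)"
  shows "matroid (two_block E k F r)" "matroid (relaxed_block E k F r)"
proof -
  have fin: "finite (E - F)" "finite F" "(E - F) \<inter> F = {}" using assms finite_subset by auto
  have "E - F \<union> F = E" "k - r + r = k" using assms by auto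
  then have "bases (two_block E k F r) \<noteq> {}"
    using bases_direct_sum_uniform_nonempty[OF fin assms(6,4)]
    by (simp add: direct_sum_uniform_constrained[OF fin])
  moreover have "bases (two_block E k F r) \<subseteq> bases (relaxed_block E k F r)"
    by (auto simp: constrained_def)
  ultimately show "matroid (two_block E k F r)" "matroid (relaxed_block E k F r)"
    using assms spread_two_block[OF assms(3,5)] by (auto intro!: matroid_constrained)
qed

lemma matroid_uniform:
  assumes "finite E" "E \<subseteq> {0<..}" "k \<le> card E" shows "matroid (constrained E k {})"
proof (rule matroid_constrained)
  obtain B where "B \<subseteq> E" "card B = k" using assms(3) obtain_subset_with_card_n by metis
  then show "bases (constrained E k {}) \<noteq> {}" by (auto simp: constrained_def)
qed (use assms in \<open>auto simp: spread_def\<close>)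

section \<open>Isomorphism types\<close>

lemma U_sum_eq:
  assumes "h \<le> n" "r \<le> k"
  shows "U_sum r k h n = two_block {1..n} k {1..h} r"
proof -
  have "{1..n} - {1..h} = {h+1..n}" "{h+1..n} \<union> {1..h} = {1..n}" "{h+1..n} \<inter> {1..h} = {}"
    using assms by auto
  then show ?thesis unfolding U_sum_def
    using assms by (subst direct_sum_uniform_constrained) auto
qed

lemma Lam_eq:
  assumes "h \<le> n" "r \<le> k" "r \<le> h" "k - r \<le> n - h"
  shows "Lam r k h n = relaxed_block {1..n} k {1..h} r"
proof -
  have "{1..n} - {1..h} = {h+1..n}" "{h+1..n} \<union> {1..h} = {1..n}" "{h+1..n} \<inter> {1..h} = {}"
    using assms by auto
  then show ?thesis unfolding U_sum_def Lam_def
    using assms by (subst relaxation_direct_sum_uniform) auto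
qed

lemma U_matroid_eq: "U_matroid k n = constrained {1..n} k {}"
  by (simp add: U_matroid_def uniform_on_def constrained_def)

lemma constrained_iso:
  assumes bij: "bij_betw \<phi> E E'" and sets: "fst ` \<A> \<subseteq> Pow E"
  shows "matroid_iso (constrained E k \<A>) (constrained E' k ((\<lambda>(A, s). (\<phi> ` A, s)) ` \<A>))"
proof -
  have sub: "A \<subseteq> E" if "(A, s) \<in> \<A>" for A s using sets that by force
  have inj: "inj_on \<phi> E" and im: "\<phi> ` E = E'" using bij by (auto simp: bij_betw_def)
  have c: "card (\<phi> ` B) = card B" if "B \<subseteq> E" for B
    using that inj by (meson card_image inj_on_subset)
  have ci: "card (\<phi> ` B \<inter> \<phi> ` A) = card (B \<inter> A)" if "B \<subseteq> E" "A \<subseteq> E" for A B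
    using that c[of "B \<inter> A"] inj_on_image_Int[OF inj that] by (metis Int_subset_iff inf.coboundedI1)
  have key: "\<phi> ` B \<in> bases (constrained E' k ((\<lambda>(A, s). (\<phi> ` A, s)) ` \<A>)) \<longleftrightarrow> B \<in> bases (constrained E k \<A>)"
    if B: "B \<subseteq> E" for B
  proof -
    have "(\<forall>(A, s)\<in>(\<lambda>(A, s). (\<phi> ` A, s)) ` \<A>. card (\<phi> ` B \<inter> A) \<le> s) \<longleftrightarrow>
        (\<forall>(A, s)\<in>\<A>. card (\<phi> ` B \<inter> \<phi> ` A) \<le> s)" by auto
    also have "\<dots> \<longleftrightarrow> (\<forall>(A, s)\<in>\<A>. card (B \<inter> A) \<le> s)"
      using ci[OF B sub] by (intro ball_cong) auto
    finally show ?thesis using B c[OF B] im by (auto simp: constrained_def)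
  qed
  have "bases (constrained E' k ((\<lambda>(A, s). (\<phi> ` A, s)) ` \<A>)) = (\<lambda>B. \<phi> ` B) ` bases (constrained E k \<A>)"
  proof (intro equalityI subsetI)
    fix X assume X: "X \<in> bases (constrained E' k ((\<lambda>(A, s). (\<phi> ` A, s)) ` \<A>))"
    then have "X \<subseteq> \<phi> ` E" using im by (auto simp: constrained_def)
    then obtain B where "B \<subseteq> E" "X = \<phi> ` B" by (meson subset_imageE)
    then show "X \<in> (\<lambda>B. \<phi> ` B) ` bases (constrained E k \<A>)" using X key by auto
  next
    fix X assume "X \<in> (\<lambda>B. \<phi> ` B) ` bases (constrained E k \<A>)"
    then obtain B where B: "B \<in> bases (constrained E k \<A>)" "X = \<phi> ` B" by auto
    then have "B \<subseteq> E" by (auto simp: constrained_def)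
    then show "X \<in> bases (constrained E' k ((\<lambda>(A, s). (\<phi> ` A, s)) ` \<A>))" using key B by auto
  qed
  then show ?thesis unfolding matroid_iso_def using bij by (auto simp: constrained_def)
qed

text \<open>\<open>U_sum\<close> and \<open>Lam\<close> place the distinguished block on
  \<open>{1..h}\<close>, so the relabelling has to carry \<open>F\<close> there as well.\<close>

lemma ex_bij_betw_initial_segment:
  assumes "finite E" "F \<subseteq> E"
  obtains \<phi> :: "'a \<Rightarrow> nat" where "bij_betw \<phi> E {1..card E}" "\<phi> ` F = {1..card F}" "\<phi> ` (E - F) = {1..card E} - {1..card F}"
proof -
  have finF: "finite F" using assms finite_subset by blast
  have le: "card F \<le> card E" using assms by (simp add: card_mono)
  obtain g where g: "bij_betw g F {1..card F}"
    using finite_same_card_bij[OF finF, of "{1..card F}"] by auto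
  have "card (E - F) = card {card F + 1..card E}" using assms finF by (simp add: card_Diff_subset)
  then obtain g' where g': "bij_betw g' (E - F) {card F + 1..card E}"
    using finite_same_card_bij[of "E - F" "{card F + 1..card E}"] assms by auto
  define \<phi> where "\<phi> x = (if x \<in> F then g x else g' x)" for x
  have 1: "bij_betw \<phi> F {1..card F}" using g by (subst bij_betw_cong[of _ _ g]) (auto simp: \<phi>_def)
  have 2: "bij_betw \<phi> (E - F) {card F + 1..card E}"
    using g' by (subst bij_betw_cong[of _ _ g']) (auto simp: \<phi>_def)
  have "bij_betw \<phi> (F \<union> (E - F)) ({1..card F} \<union> {card F + 1..card E})"
    using 1 2 by (rule bij_betw_combine) auto
  moreover have "F \<union> (E - F) = E" "{1..card F} \<union> {card F + 1..card E} = {1..card E}"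
    "{card F + 1..card E} = {1..card E} - {1..card F}" using assms le by auto
  ultimately show thesis using that 1 2 by (simp add: bij_betw_def)
qed

lemma
  assumes f: "matroid_invariant f" and E: "finite E" "E \<subseteq> {0<..}" and F: "F \<subseteq> E"
    and r: "r \<le> card F" "r \<le> k" "k - r \<le> card (E - F)"
  shows invariant_two_block: "f (two_block E k F r) = f (U_sum r k (card F) (card E))"
    and invariant_relaxed_block: "f (relaxed_block E k F r) = f (Lam r k (card F) (card E))"
proof -
  obtain \<phi> where \<phi>: "bij_betw \<phi> E {1..card E}" "\<phi> ` F = {1..card F}"
      "\<phi> ` (E - F) = {1..card E} - {1..card F}"
    using ex_bij_betw_initial_segment[OF E(1) F] .
  have le: "card F \<le> card E" using E F by (simp add: card_mono)
  have cEF: "card (E - F) = card E - card F" using E F finite_subset card_Diff_subset by metis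
  have sub: "{1..card F} \<subseteq> {1..card E}" "{1..card E} \<subseteq> {0<..}" using le by auto
  have "card ({1..card E} - {1..card F}) = card E - card F" using sub by (simp add: card_Diff_subset)
  then have m: "matroid (two_block {1..card E} k {1..card F} r)" "matroid (relaxed_block {1..card E} k {1..card F} r)"
    using r cEF by (intro matroid_two_block[OF _ sub(2,1)]; simp)+
  have subA: "fst ` {(E - F, k - r), (F, r)} \<subseteq> Pow E" using F by auto
  have subB: "fst ` {(E - F, k - r)} \<subseteq> Pow E" by auto
  have "matroid_iso (two_block E k F r) (two_block {1..card E} k {1..card F} r)"
    using constrained_iso[OF \<phi>(1) subA, where k = k] by (simp only: image_insert image_empty prod.case \<phi>(2,3))
  then show "f (two_block E k F r) = f (U_sum r k (card F) (card E))"
    using f m matroid_two_block[OF E F r] U_sum_eq[OF le r(2)] by (simp add: matroid_invariant_def)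
  have "matroid_iso (relaxed_block E k F r) (relaxed_block {1..card E} k {1..card F} r)"
    using constrained_iso[OF \<phi>(1) subB, where k = k] by (simp only: image_insert image_empty prod.case \<phi>(2,3))
  then show "f (relaxed_block E k F r) = f (Lam r k (card F) (card E))"
    using f m matroid_two_block[OF E F r] Lam_eq[OF le r(2,1)] r(3) cEF by (simp add: matroid_invariant_def)
qed

lemma invariant_uniform:
  assumes f: "matroid_invariant f" and E: "finite E" "E \<subseteq> {0<..}" and k: "k \<le> card E"
  shows "f (constrained E k {}) = f (U_matroid k (card E))"
proof -
  obtain \<phi> :: "nat \<Rightarrow> nat" where \<phi>: "bij_betw \<phi> E {1..card E}"
    using finite_same_card_bij[OF E(1), of "{1..card E}"] by auto
  have "matroid_iso (constrained E k {}) (constrained {1..card E} k {})"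
    using constrained_iso[OF \<phi>, of "{}" k] by simp
  moreover have "matroid (constrained {1..card E} k {})" using k by (intro matroid_uniform) auto
  ultimately show ?thesis
    using f matroid_uniform[OF E k] by (simp add: matroid_invariant_def U_matroid_eq)
qed

section \<open>The valuation\<close>

lemma valuation_finite_sum:
  fixes f :: "set_system \<Rightarrow> 'g::ab_group_add"
  assumes f: "valuation f" and I: "finite I"
    and Ms: "\<And>i. i \<in> I \<Longrightarrow> matroid (Ms i) \<and> ground (Ms i) = E"
    and zero: "\<And>x. x \<in> coord_space E \<Longrightarrow> (\<Sum>i\<in>I. a i * indicator (base_polytope (Ms i)) x) = 0"
  shows "(\<Sum>i\<in>I. zmult (a i) (f (Ms i))) = 0"
proof -
  obtain h where h: "bij_betw h {0..<card I} I" using ex_bij_betw_nat_finite[OF I] by blast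
  have h': "bij_betw h {..<card I} I" using h by (simp add: lessThan_atLeast0)
  have re: "(\<Sum>i\<in>I. g i) = (\<Sum>i<card I. g (h i))" for g :: "_ \<Rightarrow> 'z::comm_monoid_add"
    using sum.reindex_bij_betw[OF h', of g] by simp
  have "\<forall>i<card I. matroid (Ms (h i)) \<and> ground (Ms (h i)) = E"
    using Ms h' bij_betwE by blast
  moreover have "\<forall>x\<in>coord_space E. (\<Sum>i<card I. a (h i) * indicator (base_polytope (Ms (h i))) x) = 0"
  proof
    fix x assume "x \<in> coord_space E"
    from zero[OF this] show "(\<Sum>i<card I. a (h i) * indicator (base_polytope (Ms (h i))) x) = 0" unfolding re .
  qed
  ultimately have "(\<Sum>i<card I. zmult (a (h i)) (f (Ms (h i)))) = 0"
    using f[unfolded valuation_def, rule_format, of "card I" "\<lambda>i. Ms (h i)" E "\<lambda>i. a (h i)"] by blast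
  then show ?thesis by (simp add: re)
qed

lemma zmult_1 [simp]: "zmult 1 x = x" and zmult_minus_1 [simp]: "zmult (- 1) x = - x"
  by (simp_all add: zmult_def)

text \<open>Pairing each index with a boolean turns the differences into one family with
  coefficients 1 and -1. The same matroid may occur several times in it.\<close>

lemma valuation_difference_sum:
  fixes f :: "set_system \<Rightarrow> 'g::ab_group_add"
  assumes f: "valuation f" and I: "finite I"
    and Ms: "\<And>i. i \<in> I \<Longrightarrow> matroid (P i) \<and> ground (P i) = E" "\<And>i. i \<in> I \<Longrightarrow> matroid (Q i) \<and> ground (Q i) = E"
    and zero: "\<And>x. x \<in> coord_space E \<Longrightarrow>
      (\<Sum>i\<in>I. indicator (base_polytope (P i)) x - indicator (base_polytope (Q i)) x) = (0::int)"
  shows "(\<Sum>i\<in>I. f (P i) - f (Q i)) = 0"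
proof -
  have split: "(\<Sum>p\<in>I \<times> UNIV. g p) = (\<Sum>i\<in>I. g (i, True) + g (i, False))" for g :: "_ \<Rightarrow> 'z::comm_monoid_add"
  proof -
    have "(\<Sum>i\<in>I. g (i, True) + g (i, False)) = (\<Sum>i\<in>I. \<Sum>b\<in>UNIV. g (i, b))" by (simp add: UNIV_bool add.commute)
    also have "\<dots> = (\<Sum>p\<in>I \<times> UNIV. g p)" by (simp add: sum.cartesian_product)
    finally show ?thesis by simp
  qed
  have "(\<Sum>p\<in>I \<times> UNIV. zmult (if snd p then 1 else - 1) (f (if snd p then P (fst p) else Q (fst p)))) = 0"
  proof (rule valuation_finite_sum[OF f, where E = E])
    show "matroid (if snd p then P (fst p) else Q (fst p)) \<and> ground (if snd p then P (fst p) else Q (fst p)) = E"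
      if "p \<in> I \<times> UNIV" for p using that Ms by auto
    show "(\<Sum>p\<in>I \<times> UNIV. (if snd p then 1 else - 1 :: int) *
        indicator (base_polytope (if snd p then P (fst p) else Q (fst p))) x) = 0"
      if "x \<in> coord_space E" for x using zero[OF that] by (simp add: split)
  qed (use I in auto)
  then show ?thesis by (simp add: split)
qed

lemma slab_iff_hypersimplex:
  "x \<in> slab E k \<A> \<longleftrightarrow> x \<in> slab E k {} \<and> (\<forall>(A, s)\<in>\<A>. sum (Poly_Mapping.lookup x) A \<le> real s)"
  by (auto simp: slab_def)

text \<open>
  On the hypersimplex each summand is the indicator of \<open>x(F) > rk M F\<close>.  By \<open>stressed_pair\<close> these
  regions are disjoint, and what they leave over is the polytope of \<open>M\<close>.
\<close>

lemma polytope_identity: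
  assumes es: "elementary_split M" and x: "x \<in> coord_space (ground M)"
  shows "indicator (base_polytope M) x - indicator (base_polytope (constrained (ground M) (matroid_rank M) {})) x +
    (\<Sum>F\<in>stressed_sets M.
      indicator (base_polytope (relaxed_block (ground M) (matroid_rank M) F (rk M F))) x -
      indicator (base_polytope (two_block (ground M) (matroid_rank M) F (rk M F))) x) = (0::int)"
proof -
  define E k where "E = ground M" and "k = matroid_rank M"
  have m: "matroid M" using elementary_split_matroid[OF es] .
  have fin: "finite E" using finite_ground[OF m] by (simp add: E_def)
  let ?\<F> = "stressed_sets M"
  have finF: "finite ?\<F>" using finite_stressed_sets[OF m] .
  have F: "F \<subseteq> E" "rk M F \<le> k" if "F \<in> ?\<F>" for F
    using that stressed_subset[of M F] stressed_rk_le_rank[OF m] by (auto simp: stressed_sets_def E_def k_def m)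
  have pM: "base_polytope M = slab E k ((\<lambda>F. (F, rk M F)) ` ?\<F>)"
    using base_polytope_constrained[OF fin spread_stressed_sets[OF m, folded E_def k_def]]
      elementary_split_constrained[OF es, folded E_def k_def] by simp
  have pU: "base_polytope (constrained E k {}) = slab E k {}"
    by (rule base_polytope_constrained[OF fin]) (simp add: spread_def)
  have pR: "base_polytope (relaxed_block E k F (rk M F)) = slab E k {(E - F, k - rk M F)}"
    and pT: "base_polytope (two_block E k F (rk M F)) = slab E k {(E - F, k - rk M F), (F, rk M F)}"
    if "F \<in> ?\<F>" for F
    using that F by (auto intro!: base_polytope_constrained[OF fin] spread_two_block)
  show ?thesis
    unfolding E_def[symmetric] k_def[symmetric]
  proof (cases "x \<in> slab E k {}")
    case False
    then have "x \<notin> slab E k \<A>" for \<A> using slab_iff_hypersimplex by blast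
    then show "indicator (base_polytope M) x - indicator (base_polytope (constrained E k {})) x +
      (\<Sum>F\<in>?\<F>. indicator (base_polytope (relaxed_block E k F (rk M F))) x -
         indicator (base_polytope (two_block E k F (rk M F))) x) = (0::int)"
      by (simp add: pM pU pR pT)
  next
    case True
    let ?x = "Poly_Mapping.lookup x"
    have xb: "0 \<le> ?x i" "?x i \<le> 1" if "i \<in> E" for i using True that by (auto simp: slab_def)
    have xE: "sum ?x E = real k" using True by (simp add: slab_def)
    define V where "V F \<longleftrightarrow> real (rk M F) < sum ?x F" for F
    have cut: "indicator (base_polytope (relaxed_block E k F (rk M F))) x -
         indicator (base_polytope (two_block E k F (rk M F))) x = (of_bool (V F) :: int)" if "F \<in> ?\<F>" for F
    proof -
      \<comment> \<open>Hence the bound on \<open>E - F\<close> reads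
        \<open>x(F) \<ge> rk M F\<close>, and adding the bound on \<open>F\<close> leaves
        \<open>x(F) = rk M F\<close>. The difference of the indicators marks the strict
        inequality.\<close>
      have "sum ?x (E - F) = real k - sum ?x F" using fin F[OF that] xE by (simp add: sum_diff)
      then show ?thesis
        unfolding pR[OF that] pT[OF that] indicator_def
        using True F[OF that] slab_iff_hypersimplex[of x E k "{(E - F, k - rk M F)}"]
          slab_iff_hypersimplex[of x E k "{(E - F, k - rk M F), (F, rk M F)}"]
        by (auto simp: V_def of_nat_diff)
    qed
    \<comment> \<open>If both sets were exceeded, then \<open>x(F) + x(G) = x(F \<union> G) + x(F
      \<inter> G) \<le> k + card (F \<inter> G) \<le> rk M F + rk M G\<close> would be a
      contradiction.\<close>
    have uniq: "F = G" if "F \<in> ?\<F>" "G \<in> ?\<F>" "V F" "V G" for F G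
    proof (rule ccontr)
      assume "F \<noteq> G"
      then have le: "k + card (F \<inter> G) \<le> rk M F + rk M G"
        using stressed_pair[OF m, of F G] that by (auto simp: stressed_sets_def k_def)
      have sub: "F \<subseteq> E" "G \<subseteq> E" using F that by auto
      then have fFG: "finite F" "finite G" using fin finite_subset by auto
      have "sum ?x F + sum ?x G = sum ?x (F \<union> G) + sum ?x (F \<inter> G)"
        using sum.union_inter[OF fFG, of ?x] by simp
      moreover have "sum ?x (F \<union> G) \<le> real k"
        using xE fin sub xb by (metis Diff_iff Un_least sum_mono2)
      moreover have "sum ?x (F \<inter> G) \<le> (\<Sum>i\<in>F \<inter> G. 1)"
        using xb sub by (intro sum_mono) auto
      moreover have "real k + real (card (F \<inter> G)) \<le> real (rk M F) + real (rk M G)"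
        using le by (metis of_nat_add of_nat_mono)
      ultimately show False using that by (simp add: V_def)
    qed
    have "(\<Sum>F\<in>?\<F>. indicator (base_polytope (relaxed_block E k F (rk M F))) x -
         indicator (base_polytope (two_block E k F (rk M F))) x) = (\<Sum>F\<in>?\<F>. of_bool (V F) :: int)"
      using cut by (rule sum.cong[OF refl])
    also have "\<dots> = of_bool (\<exists>F\<in>?\<F>. V F)"
    proof (cases "\<exists>F\<in>?\<F>. V F")
      case True
      then obtain G where G: "G \<in> ?\<F>" "V G" by blast
      have "(\<Sum>F\<in>?\<F>. of_bool (V F) :: int) = (\<Sum>F\<in>?\<F>. if F = G then 1 else 0)"
        using G uniq by (intro sum.cong) auto
      then show ?thesis using G finF by auto
    qed auto
    finally have s: "(\<Sum>F\<in>?\<F>. indicator (base_polytope (relaxed_block E k F (rk M F))) x -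
         indicator (base_polytope (two_block E k F (rk M F))) x) = (of_bool (\<exists>F\<in>?\<F>. V F) :: int)" .
    have "x \<in> base_polytope M \<longleftrightarrow> \<not> (\<exists>F\<in>?\<F>. V F)"
      unfolding pM using True slab_iff_hypersimplex[of x E k "(\<lambda>F. (F, rk M F)) ` ?\<F>"]
      by (auto simp: V_def not_less)
    then show "indicator (base_polytope M) x - indicator (base_polytope (constrained E k {})) x +
      (\<Sum>F\<in>?\<F>. indicator (base_polytope (relaxed_block E k F (rk M F))) x -
         indicator (base_polytope (two_block E k F (rk M F))) x) = (0::int)"
      unfolding s pU using True by (simp add: indicator_def)
  qed
qed

section \<open>Collecting the stressed sets by rank and size\<close>

lemma sum_const_zmult: "(\<Sum>i\<in>A. x) = zmult (int (card A)) x" for x :: "'g::ab_group_add"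
proof (cases "finite A")
  case True
  then obtain h where "bij_betw h {0..<card A} A" using ex_bij_betw_nat_finite by blast
  then have "(\<Sum>i\<in>A. x) = (\<Sum>i\<in>{0..<card A}. x)" using sum.reindex_bij_betw[of h "{0..<card A}" A "\<lambda>_. x"] by simp
  then show ?thesis by (simp add: zmult_def lessThan_atLeast0)
\<comment> \<open>For infinite \<open>A\<close> both the sum and \<open>card A\<close> default to
  0.\<close>
qed (simp add: zmult_def)

theorem theorem1p4:
  fixes M :: set_system and k n :: nat and f :: "set_system \<Rightarrow> 'g::ab_group_add"
  assumes "elementary_split M" and "matroid_rank M = k" and "card (ground M) = n"
    and "valuative_invariant f"
  shows "f M = f (U_matroid k n) -
           (\<Sum>(r, h) | r \<le> h \<and> r \<le> k \<and> h \<le> n \<and> k - r \<le> n - h.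
              zmult (int (stressed_count M r h)) (f (Lam r k h n) - f (U_sum r k h n)))"
proof -
  let ?E = "ground M" and ?\<F> = "stressed_sets M"
  have val: "valuation f" and inv: "matroid_invariant f"
    using assms(4) by (auto simp: valuative_invariant_def)
  have m: "matroid M" using elementary_split_matroid[OF assms(1)] .
  have E: "finite ?E" "?E \<subseteq> {0<..}" using m by (auto simp: matroid_def)
  have finF: "finite ?\<F>" using finite_stressed_sets[OF m] .
  have kn: "k \<le> card ?E" using rk_le_card[OF m E(1)] assms(2) by (simp add: matroid_rank_def)
  have F: "F \<subseteq> ?E" "rk M F \<le> card F" "rk M F \<le> k" "k - rk M F \<le> card (?E - F)" if "F \<in> ?\<F>" for F
    using that stressed_subset[OF m] stressed_rk_le[OF m] stressed_rk_le_rank[OF m] stressed_corank_le[OF m] assms(2)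
    by (auto simp: stressed_sets_def)
  have cEF: "card (?E - F) = n - card F" "card F \<le> n" if "F \<in> ?\<F>" for F
    using F(1)[OF that] E(1) assms(3) by (auto simp: card_Diff_subset finite_subset card_mono)
  \<comment> \<open>The index \<open>None\<close> pairs \<open>M\<close> with the uniform matroid,
    and \<open>Some F\<close> pairs the relaxation with the direct sum, so that
    \<open>polytope_identity\<close> is a single sum of differences.\<close>
  define P where "P i = (case i of None \<Rightarrow> M | Some F \<Rightarrow> relaxed_block ?E k F (rk M F))" for i
  define Q where "Q i = (case i of None \<Rightarrow> constrained ?E k {} | Some F \<Rightarrow> two_block ?E k F (rk M F))" for i
  have I: "(\<Sum>i\<in>insert None (Some ` ?\<F>). g i) = g None + (\<Sum>F\<in>?\<F>. g (Some F))" for g :: "_ \<Rightarrow> 'z::comm_monoid_add"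
    using finF by (simp add: sum.reindex image_iff)
  have g: "ground (constrained E' k' \<A>) = E'" for E' k' \<A> by (simp add: constrained_def)
  have "(\<Sum>i\<in>insert None (Some ` ?\<F>). f (P i) - f (Q i)) = 0"
  proof (rule valuation_difference_sum[OF val, where E = ?E])
    show "finite (insert None (Some ` ?\<F>))" using finF by simp
    show "matroid (P i) \<and> ground (P i) = ?E" if "i \<in> insert None (Some ` ?\<F>)" for i
      using that m matroid_two_block[OF E F] by (auto simp: P_def g)
    show "matroid (Q i) \<and> ground (Q i) = ?E" if "i \<in> insert None (Some ` ?\<F>)" for i
      using that matroid_uniform[OF E kn] matroid_two_block[OF E F] by (auto simp: Q_def g)
    show "(\<Sum>i\<in>insert None (Some ` ?\<F>). indicator (base_polytope (P i)) x - indicator (base_polytope (Q i)) x) = (0::int)"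
      if "x \<in> coord_space ?E" for x
      using polytope_identity[OF assms(1) that] unfolding I by (simp add: P_def Q_def assms(2))
  qed
  then have "f M - f (constrained ?E k {}) +
      (\<Sum>F\<in>?\<F>. f (relaxed_block ?E k F (rk M F)) - f (two_block ?E k F (rk M F))) = 0"
    unfolding I by (simp add: P_def Q_def)
  then have "f M = f (U_matroid k n) - (\<Sum>F\<in>?\<F>. f (relaxed_block ?E k F (rk M F)) - f (two_block ?E k F (rk M F)))"
    using invariant_uniform[OF inv E kn] assms(3) by (simp add: algebra_simps eq_neg_iff_add_eq_0)
  also have "(\<Sum>F\<in>?\<F>. f (relaxed_block ?E k F (rk M F)) - f (two_block ?E k F (rk M F))) =
      (\<Sum>F\<in>?\<F>. f (Lam (rk M F) k (card F) n) - f (U_sum (rk M F) k (card F) n))"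
    using invariant_two_block[OF inv E F] invariant_relaxed_block[OF inv E F] assms(3)
    by (intro sum.cong) auto
  also have "\<dots> = (\<Sum>(r, h) | r \<le> h \<and> r \<le> k \<and> h \<le> n \<and> k - r \<le> n - h.
              zmult (int (stressed_count M r h)) (f (Lam r k h n) - f (U_sum r k h n)))"
    (is "_ = sum _ ?T")
  proof -
    let ?d = "\<lambda>F. f (Lam (rk M F) k (card F) n) - f (U_sum (rk M F) k (card F) n)"
    \<comment> \<open>Every stressed set has its rank and size in \<open>?T\<close>, so grouping
      loses nothing. Pairs that do not occur contribute an empty sum.\<close>
    have "finite ?T" by (rule finite_subset[of _ "{..k} \<times> {..n}"]) auto
    moreover have "(\<lambda>F. (rk M F, card F)) ` ?\<F> \<subseteq> ?T" using F cEF by auto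
    ultimately have "sum ?d ?\<F> = (\<Sum>p\<in>?T. sum ?d {F \<in> ?\<F>. (rk M F, card F) = p})"
      using sum.group[OF finF, of ?T "\<lambda>F. (rk M F, card F)" ?d] by simp
    also have "\<dots> = (\<Sum>(r, h)\<in>?T. zmult (int (stressed_count M r h)) (f (Lam r k h n) - f (U_sum r k h n)))"
    proof (intro sum.cong refl)
      fix p assume "p \<in> ?T"
      obtain r h where p: "p = (r, h)" by (cases p)
      have "{F \<in> ?\<F>. (rk M F, card F) = p} = {A. stressed M A \<and> cover M A \<noteq> {} \<and> card A = h \<and> rk M A = r}"
        by (auto simp: p stressed_sets_def)
      moreover have "sum ?d {F \<in> ?\<F>. (rk M F, card F) = p} =
          (\<Sum>F\<in>{F \<in> ?\<F>. (rk M F, card F) = p}. f (Lam r k h n) - f (U_sum r k h n))"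
        by (intro sum.cong) (auto simp: p)
      ultimately show "sum ?d {F \<in> ?\<F>. (rk M F, card F) = p} =
          (case p of (r, h) \<Rightarrow> zmult (int (stressed_count M r h)) (f (Lam r k h n) - f (U_sum r k h n)))"
        by (simp only: p prod.case sum_const_zmult stressed_count_def)
    qed
    finally show ?thesis .
  qed
  finally show ?thesis .
qed

end
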